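(* Every element $f\in LGL_2$ can be written in the form $$f=f_+\,\mathrm{diag}(z^{n_1},z^{n_2})\,f_-$$ where $f_\pm\in LGL_2^\pm$ and $n_1,n_2\in\mathbb Z$.
   Context: $LGL_2$ is the group of germs at $0$ of holomorphic maps on the punctured disc with values in $GL_2(\mathbb C)$: equivalence classes of pairs $(R,f)$, where $R>0$ and $f:\{z\in\mathbb C:0<|z|\le R\}\to GL_2(\mathbb C)$ is continuous and holomorphic in the interior, two pairs being equivalent if the maps agree on some smaller punctured disc. $LGL_2^+$ is the subgroup of germs of $GL_2(\mathbb C)$-valued holomorphic maps around $0$; $LGL_2^-$ is the subgroup of (germs of) $GL_2(\mathbb C)$-valued holomorphic maps on $\mathbb P^1(\mathbb C)\setminus\{0\}$ (including $\infty$). *)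

theory Defs
  imports "HOL-Analysis.Analysis" "HOL-Algebra.Group"
begin

type_synonym cmat2 = "complex ^ 2 ^ 2"

definition mat_holomorphic_on :: "(complex \<Rightarrow> cmat2) \<Rightarrow> complex set \<Rightarrow> bool"
    (infixl "mat'_holomorphic'_on" 50) where
  "f mat_holomorphic_on S \<longleftrightarrow> (\<forall>i j. (\<lambda>z. f z $ i $ j) holomorphic_on S)"

text \<open>
  Maps are total functions; in a pair \<open>(R, f)\<close> only the values of \<open>f\<close> on the punctured
  disc \<open>cball 0 R - {0}\<close> matter, and the germ relation ignores all other values.
\<close>

definition punctured_maps :: "(real \<times> (complex \<Rightarrow> cmat2)) set" where
  "punctured_maps = {(R, f). R > 0 \<and> (\<forall>z\<in>cball 0 R - {0}. invertible (f z)) \<and>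
     continuous_on (cball 0 R - {0}) f \<and> f mat_holomorphic_on (ball 0 R - {0})}"

definition germ_rel :: "((real \<times> (complex \<Rightarrow> cmat2)) \<times> (real \<times> (complex \<Rightarrow> cmat2))) set" where
  "germ_rel = {((R, f), (S, g)). (R, f) \<in> punctured_maps \<and> (S, g) \<in> punctured_maps \<and>
     (\<exists>r. 0 < r \<and> r \<le> R \<and> r \<le> S \<and> (\<forall>z\<in>cball 0 r - {0}. f z = g z))}"

type_synonym germ = "(real \<times> (complex \<Rightarrow> cmat2)) set"

definition germ :: "real \<Rightarrow> (complex \<Rightarrow> cmat2) \<Rightarrow> germ" where
  "germ R f = germ_rel `` {(R, f)}"

definition LGL2 :: "germ monoid" where
  "LGL2 = \<lparr>carrier = punctured_maps // germ_rel,
     mult = (\<lambda>A B. \<Union>(R, f)\<in>A. \<Union>(S, g)\<in>B. germ (min R S) (\<lambda>z. f z ** g z)),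
     one = germ 1 (\<lambda>z. mat 1)\<rparr>"

definition LGL2_plus :: "germ set" where
  "LGL2_plus = {germ R f | R f. R > 0 \<and>
     (\<exists>U. open U \<and> cball 0 R \<subseteq> U \<and> f mat_holomorphic_on U \<and> (\<forall>z\<in>U. invertible (f z)))}"

text \<open>
  A holomorphic map on the Riemann sphere minus \<open>0\<close> is given by its restriction \<open>f\<close>
  to \<open>- {0}\<close> and its value \<open>L\<close> at infinity; holomorphy at infinity is expressed in the
  chart \<open>w = 1 / z\<close>.
\<close>

definition LGL2_minus :: "germ set" where
  "LGL2_minus = {germ R f | R f. R > 0 \<and>
     f mat_holomorphic_on (- {0}) \<and> (\<forall>z\<in>- {0}. invertible (f z)) \<and>
     (\<exists>L. invertible L \<and> (\<lambda>w. if w = 0 then L else f (1 / w)) mat_holomorphic_on UNIV)}"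

definition diag_powi :: "int \<Rightarrow> int \<Rightarrow> complex \<Rightarrow> cmat2" where
  "diag_powi m n z = vector [vector [z powi m, 0], vector [0, z powi n]]"

text \<open>The rest of this theory verifies that these are a group and two subgroups.\<close>

lemma equiv_germ_rel: "equiv punctured_maps germ_rel"
proof (rule equivI)
  show "germ_rel \<subseteq> punctured_maps \<times> punctured_maps"
    by (auto simp: germ_rel_def)
  show "refl_on punctured_maps germ_rel"
    unfolding refl_on_def germ_rel_def punctured_maps_def by auto
  show "sym germ_rel"
    by (rule symI) (force simp: germ_rel_def)
  show "trans germ_rel"
  proof (rule transI)
    fix x y z assume "(x, y) \<in> germ_rel" "(y, z) \<in> germ_rel"
    then obtain R f S g T h r s where xyz: "x = (R, f)" "y = (S, g)" "z = (T, h)"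
      and pm: "x \<in> punctured_maps" "z \<in> punctured_maps"
      and r: "0 < r" "r \<le> R" "r \<le> S" "\<forall>z\<in>cball 0 r - {0}. f z = g z"
      and s: "0 < s" "s \<le> S" "s \<le> T" "\<forall>z\<in>cball 0 s - {0}. g z = h z"
      by (cases x; cases y; cases z) (auto simp: germ_rel_def)
    have "0 < min r s" "min r s \<le> R" "min r s \<le> T" "\<forall>z\<in>cball 0 (min r s) - {0}. f z = h z"
      using r s by auto
    then show "(x, z) \<in> germ_rel"
      unfolding germ_rel_def xyz using pm xyz by blast
  qed
qed

lemma germ_eqI:
  assumes "(R, f) \<in> punctured_maps" "(S, g) \<in> punctured_maps"
    "0 < r" "\<And>z. z \<noteq> 0 \<Longrightarrow> norm z \<le> r \<Longrightarrow> f z = g z"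
  shows "germ R f = germ S g"
proof -
  have "0 < min r (min R S)" "min r (min R S) \<le> R" "min r (min R S) \<le> S"
    "\<forall>z\<in>cball 0 (min r (min R S)) - {0}. f z = g z"
    using assms by (auto simp: punctured_maps_def)
  then have "((R, f), (S, g)) \<in> germ_rel"
    unfolding germ_rel_def using assms(1,2) by blast
  then show ?thesis
    unfolding germ_def by (rule equiv_class_eq[OF equiv_germ_rel])
qed

lemma continuous_on_mat_iff:
  fixes f :: "complex \<Rightarrow> cmat2"
  shows "continuous_on S f \<longleftrightarrow> (\<forall>i j. continuous_on S (\<lambda>z. f z $ i $ j))"
proof
  assume "\<forall>i j. continuous_on S (\<lambda>z. f z $ i $ j)"
  then have "continuous_on S (\<lambda>z. \<chi> i j. f z $ i $ j)"
    by (intro continuous_on_vec_lambda) auto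
  then show "continuous_on S f" by (simp add: vec_lambda_unique)
qed (auto intro!: continuous_on_component)

lemma mat_mult_nth: "((A::cmat2) ** B) $ i $ j = A $ i $ 1 * B $ 1 $ j + A $ i $ 2 * B $ 2 $ j"
  by (simp add: matrix_matrix_mult_def sum_2)

lemma mat_holomorphic_mult:
  "f mat_holomorphic_on S \<Longrightarrow> g mat_holomorphic_on S \<Longrightarrow> (\<lambda>z. f z ** g z) mat_holomorphic_on S"
  unfolding mat_holomorphic_on_def mat_mult_nth by (auto intro!: holomorphic_intros)

lemma mat_holomorphic_subset:
  "f mat_holomorphic_on S \<Longrightarrow> T \<subseteq> S \<Longrightarrow> f mat_holomorphic_on T"
  unfolding mat_holomorphic_on_def using holomorphic_on_subset by blast

definition inv2 :: "cmat2 \<Rightarrow> cmat2" where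
  "inv2 A = vector [vector [A$2$2 / det A, - A$1$2 / det A], vector [- A$2$1 / det A, A$1$1 / det A]]"

lemma inv2_right: "invertible A \<Longrightarrow> A ** inv2 A = mat 1"
  by (simp add: invertible_det_nz vec_eq_iff forall_2 mat_mult_nth inv2_def mat_def divide_simps)
     (simp add: det_2 algebra_simps)

lemma inv2_left: "invertible A \<Longrightarrow> inv2 A ** A = mat 1"
  using inv2_right matrix_left_right_inverse by blast

lemma invertible_inv2: "invertible A \<Longrightarrow> invertible (inv2 A)"
  unfolding invertible_def using inv2_left inv2_right invertible_def by blast

lemma invertible_one: "invertible (mat 1 :: cmat2)"
  by (simp add: invertible_det_nz)

lemma mat_holomorphic_inv2:
  assumes "f mat_holomorphic_on S" "\<And>z. z \<in> S \<Longrightarrow> invertible (f z)"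
  shows "(\<lambda>z. inv2 (f z)) mat_holomorphic_on S"
  using assms unfolding mat_holomorphic_on_def forall_2 inv2_def invertible_det_nz det_2
  by (auto intro!: holomorphic_intros)

lemma mat_holomorphic_const: "(\<lambda>z. A) mat_holomorphic_on S"
  unfolding mat_holomorphic_on_def by auto

lemma mat_holomorphic_imp_continuous: "f mat_holomorphic_on S \<Longrightarrow> continuous_on S f"
  unfolding mat_holomorphic_on_def continuous_on_mat_iff
  using holomorphic_on_imp_continuous_on by blast

lemma punctured_maps_holomorphic:
  assumes "R > 0" "f mat_holomorphic_on S" "cball 0 R - {0} \<subseteq> S" "\<And>z. z \<in> S \<Longrightarrow> invertible (f z)"
  shows "(R, f) \<in> punctured_maps"
proof -
  have "ball 0 R - {0} \<subseteq> S"
    using assms(3) ball_subset_cball by blast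
  then show ?thesis
    using assms mat_holomorphic_subset mat_holomorphic_imp_continuous continuous_on_subset
    unfolding punctured_maps_def by blast
qed

lemma diag_powi_punctured_maps: "(1, diag_powi m n) \<in> punctured_maps"
proof (rule punctured_maps_holomorphic)
  show "diag_powi m n mat_holomorphic_on - {0}"
    unfolding mat_holomorphic_on_def forall_2 diag_powi_def
    by (auto intro!: holomorphic_intros)
qed (auto simp: invertible_det_nz det_2 diag_powi_def)

lemma punctured_maps_one: "(1, \<lambda>z. mat 1) \<in> punctured_maps"
  by (rule punctured_maps_holomorphic[of _ _ UNIV]) (auto simp: mat_holomorphic_const invertible_one)

lemma punctured_maps_mult:
  assumes "(R, f) \<in> punctured_maps" "(S, g) \<in> punctured_maps"
  shows "(min R S, \<lambda>z. f z ** g z) \<in> punctured_maps"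
proof -
  have sub: "cball 0 (min R S) - {0} \<subseteq> cball 0 R - {0::complex}"
    "cball 0 (min R S) - {0} \<subseteq> cball 0 S - {0::complex}"
    "ball 0 (min R S) - {0} \<subseteq> ball 0 R - {0::complex}"
    "ball 0 (min R S) - {0} \<subseteq> ball 0 S - {0::complex}"
    by auto
  have "continuous_on (cball 0 (min R S) - {0}) f" "continuous_on (cball 0 (min R S) - {0}) g"
    "f mat_holomorphic_on (ball 0 (min R S) - {0})" "g mat_holomorphic_on (ball 0 (min R S) - {0})"
    using assms sub continuous_on_subset mat_holomorphic_subset
    unfolding punctured_maps_def by blast+
  then have "continuous_on (cball 0 (min R S) - {0}) (\<lambda>z. f z ** g z)"
    "(\<lambda>z. f z ** g z) mat_holomorphic_on (ball 0 (min R S) - {0})"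
    unfolding continuous_on_mat_iff mat_mult_nth
    by (auto intro!: continuous_on_add continuous_on_mult mat_holomorphic_mult)
  then show ?thesis
    using assms by (auto simp: punctured_maps_def intro!: invertible_mult)
qed

lemma punctured_maps_inv:
  assumes "(R, f) \<in> punctured_maps"
  shows "(R, \<lambda>z. inv2 (f z)) \<in> punctured_maps"
proof -
  have "continuous_on (cball 0 R - {0}) (\<lambda>z. inv2 (f z))"
    using assms unfolding punctured_maps_def continuous_on_mat_iff forall_2 inv2_def
      invertible_det_nz det_2
    by (auto intro!: continuous_intros)
  then show ?thesis
    using assms by (auto simp: punctured_maps_def intro!: invertible_inv2 mat_holomorphic_inv2)
qed

lemma carrier_LGL2_iff: "A \<in> carrier LGL2 \<longleftrightarrow> (\<exists>R f. (R, f) \<in> punctured_maps \<and> A = germ R f)"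
  by (auto simp: LGL2_def quotient_def germ_def)

lemma germ_carrier: "(R, f) \<in> punctured_maps \<Longrightarrow> germ R f \<in> carrier LGL2"
  by (auto simp: carrier_LGL2_iff)

lemma germ_mult:
  assumes "(R, f) \<in> punctured_maps" "(S, g) \<in> punctured_maps"
  shows "germ R f \<otimes>\<^bsub>LGL2\<^esub> germ S g = germ (min R S) (\<lambda>z. f z ** g z)"
proof -
  let ?m = "\<lambda>(R, f) (S, g). germ (min R S) (\<lambda>z. f z ** g z)"
  have "congruent2 germ_rel germ_rel ?m"
  proof (rule congruent2I')
    fix x x' y y' assume "(x, x') \<in> germ_rel" "(y, y') \<in> germ_rel"
    then obtain R f R' f' S g S' g' r s where xy: "x = (R, f)" "x' = (R', f')" "y = (S, g)" "y' = (S', g')"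
      and pm: "(R, f) \<in> punctured_maps" "(R', f') \<in> punctured_maps"
        "(S, g) \<in> punctured_maps" "(S', g') \<in> punctured_maps"
      and r: "0 < r" "\<forall>z\<in>cball 0 r - {0}. f z = f' z"
      and s: "0 < s" "\<forall>z\<in>cball 0 s - {0}. g z = g' z"
      by (cases x; cases x'; cases y; cases y') (auto simp: germ_rel_def)
    have "germ (min R S) (\<lambda>z. f z ** g z) = germ (min R' S') (\<lambda>z. f' z ** g' z)"
      by (rule germ_eqI[of _ _ _ _ "min r s"]) (use pm r s in \<open>auto intro: punctured_maps_mult\<close>)
    then show "?m x y = ?m x' y'" by (simp add: xy)
  qed
  from UN_equiv_class2[OF equiv_germ_rel equiv_germ_rel this assms] show ?thesis
    by (simp add: LGL2_def germ_def case_prod_unfold)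
qed

lemma one_LGL2: "\<one>\<^bsub>LGL2\<^esub> = germ 1 (\<lambda>z. mat 1)"
  by (simp add: LGL2_def)

lemma germ_inv_left:
  assumes "(R, f) \<in> punctured_maps"
  shows "germ R (\<lambda>z. inv2 (f z)) \<otimes>\<^bsub>LGL2\<^esub> germ R f = \<one>\<^bsub>LGL2\<^esub>"
proof -
  have "germ (min R R) (\<lambda>z. inv2 (f z) ** f z) = germ 1 (\<lambda>z. mat 1)"
    by (rule germ_eqI[OF _ _, of _ _ _ _ R])
       (use assms punctured_maps_one punctured_maps_mult[OF punctured_maps_inv[OF assms] assms] in
        \<open>auto simp: punctured_maps_def inv2_left\<close>)
  then show ?thesis
    by (simp add: germ_mult[OF punctured_maps_inv[OF assms] assms] one_LGL2)
qed

theorem group_LGL2: "group LGL2"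
proof (rule groupI)
  show "\<one>\<^bsub>LGL2\<^esub> \<in> carrier LGL2"
    by (simp add: one_LGL2 germ_carrier punctured_maps_one)
next
  fix x y assume "x \<in> carrier LGL2" "y \<in> carrier LGL2"
  then show "x \<otimes>\<^bsub>LGL2\<^esub> y \<in> carrier LGL2"
    unfolding carrier_LGL2_iff using germ_mult punctured_maps_mult by blast
next
  fix x y z assume "x \<in> carrier LGL2" "y \<in> carrier LGL2" "z \<in> carrier LGL2"
  then show "x \<otimes>\<^bsub>LGL2\<^esub> y \<otimes>\<^bsub>LGL2\<^esub> z = x \<otimes>\<^bsub>LGL2\<^esub> (y \<otimes>\<^bsub>LGL2\<^esub> z)"
    by (auto simp: carrier_LGL2_iff germ_mult punctured_maps_mult matrix_mul_assoc min.assoc)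
next
  fix x assume "x \<in> carrier LGL2"
  then obtain R f where Rf: "(R, f) \<in> punctured_maps" "x = germ R f"
    by (auto simp: carrier_LGL2_iff)
  have "germ (min 1 R) (\<lambda>z. mat 1 ** f z) = germ R f"
    by (rule germ_eqI[OF punctured_maps_mult[OF punctured_maps_one Rf(1)] Rf(1), of 1]) auto
  then show "\<one>\<^bsub>LGL2\<^esub> \<otimes>\<^bsub>LGL2\<^esub> x = x"
    by (simp add: one_LGL2 germ_mult[OF punctured_maps_one Rf(1)] Rf(2))
  show "\<exists>y\<in>carrier LGL2. y \<otimes>\<^bsub>LGL2\<^esub> x = \<one>\<^bsub>LGL2\<^esub>"
    using germ_inv_left[OF Rf(1)] germ_carrier[OF punctured_maps_inv[OF Rf(1)]] Rf(2) by blast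
qed

lemma germ_inv:
  assumes "(R, f) \<in> punctured_maps"
  shows "inv\<^bsub>LGL2\<^esub> (germ R f) = germ R (\<lambda>z. inv2 (f z))"
  by (rule group.inv_equality[OF group_LGL2 germ_inv_left])
     (auto simp: germ_carrier punctured_maps_inv assms)

lemma LGL2_plusE:
  assumes "x \<in> LGL2_plus"
  obtains R f U where "x = germ R f" "R > 0" "open U" "cball 0 R \<subseteq> U" "f mat_holomorphic_on U"
    "\<forall>z\<in>U. invertible (f z)" "(R, f) \<in> punctured_maps"
proof -
  from assms obtain R f U where *: "x = germ R f" "R > 0" "open U" "cball 0 R \<subseteq> U"
    "f mat_holomorphic_on U" "\<forall>z\<in>U. invertible (f z)"
    unfolding LGL2_plus_def by blast
  moreover have "(R, f) \<in> punctured_maps"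
    using *(4,6) by (intro punctured_maps_holomorphic[OF *(2,5)]) auto
  ultimately show ?thesis using that by blast
qed

theorem subgroup_LGL2_plus: "subgroup LGL2_plus LGL2"
proof (rule group.subgroupI[OF group_LGL2])
  show "LGL2_plus \<subseteq> carrier LGL2"
    by (auto elim!: LGL2_plusE intro: germ_carrier)
  have "germ 1 (\<lambda>z. mat 1) \<in> LGL2_plus"
    unfolding LGL2_plus_def
    using mat_holomorphic_const invertible_one zero_less_one open_UNIV subset_UNIV by blast
  then show "LGL2_plus \<noteq> {}" by blast
next
  fix x assume "x \<in> LGL2_plus"
  then obtain R f U where x: "x = germ R f" "R > 0" "open U" "cball 0 R \<subseteq> U" "f mat_holomorphic_on U"
    "\<forall>z\<in>U. invertible (f z)" "(R, f) \<in> punctured_maps" by (rule LGL2_plusE)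
  have "(\<lambda>z. inv2 (f z)) mat_holomorphic_on U" "\<forall>z\<in>U. invertible (inv2 (f z))"
    using x by (auto intro!: mat_holomorphic_inv2 invertible_inv2)
  then show "inv\<^bsub>LGL2\<^esub> x \<in> LGL2_plus"
    unfolding x(1) germ_inv[OF x(7)] LGL2_plus_def using x(2-4) by blast
next
  fix x y assume "x \<in> LGL2_plus" "y \<in> LGL2_plus"
  then obtain R f U S g V where x: "x = germ R f" "R > 0" "open U" "cball 0 R \<subseteq> U" "f mat_holomorphic_on U"
    "\<forall>z\<in>U. invertible (f z)" "(R, f) \<in> punctured_maps"
    and y: "y = germ S g" "S > 0" "open V" "cball 0 S \<subseteq> V" "g mat_holomorphic_on V"
    "\<forall>z\<in>V. invertible (g z)" "(S, g) \<in> punctured_maps"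
    by (elim LGL2_plusE) blast
  have "min R S > 0" "open (U \<inter> V)" "cball 0 (min R S) \<subseteq> U \<inter> V"
    "(\<lambda>z. f z ** g z) mat_holomorphic_on U \<inter> V" "\<forall>z\<in>U \<inter> V. invertible (f z ** g z)"
    using x y by (auto intro!: mat_holomorphic_mult invertible_mult intro: mat_holomorphic_subset)
  then show "x \<otimes>\<^bsub>LGL2\<^esub> y \<in> LGL2_plus"
    unfolding x(1) y(1) germ_mult[OF x(7) y(7)] LGL2_plus_def by blast
qed

lemma LGL2_minusE:
  assumes "x \<in> LGL2_minus"
  obtains R f L where "x = germ R f" "R > 0" "f mat_holomorphic_on - {0}"
    "\<forall>z\<in>- {0}. invertible (f z)" "invertible L"
    "(\<lambda>w. if w = 0 then L else f (1 / w)) mat_holomorphic_on UNIV" "(R, f) \<in> punctured_maps"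
proof -
  from assms obtain R f L where *: "x = germ R f" "R > 0" "f mat_holomorphic_on - {0}"
    "\<forall>z\<in>- {0}. invertible (f z)" "invertible L"
    "(\<lambda>w. if w = 0 then L else f (1 / w)) mat_holomorphic_on UNIV"
    unfolding LGL2_minus_def by blast
  moreover have "(R, f) \<in> punctured_maps"
    using *(4) by (intro punctured_maps_holomorphic[OF *(2,3)]) auto
  ultimately show ?thesis using that by blast
qed

theorem subgroup_LGL2_minus: "subgroup LGL2_minus LGL2"
proof (rule group.subgroupI[OF group_LGL2])
  show "LGL2_minus \<subseteq> carrier LGL2"
    by (auto elim!: LGL2_minusE intro: germ_carrier)
  have "(\<lambda>w::complex. if w = 0 then mat 1 else mat 1) mat_holomorphic_on UNIV"
    by (simp add: mat_holomorphic_const)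
  then have "germ 1 (\<lambda>z. mat 1) \<in> LGL2_minus"
    unfolding LGL2_minus_def using mat_holomorphic_const invertible_one zero_less_one by blast
  then show "LGL2_minus \<noteq> {}" by blast
next
  fix x assume "x \<in> LGL2_minus"
  then obtain R f L where x: "x = germ R f" "R > 0" "f mat_holomorphic_on - {0}"
    "\<forall>z\<in>- {0}. invertible (f z)" "invertible L"
    "(\<lambda>w. if w = 0 then L else f (1 / w)) mat_holomorphic_on UNIV" "(R, f) \<in> punctured_maps"
    by (rule LGL2_minusE) blast
  have "(\<lambda>z. inv2 (f z)) mat_holomorphic_on - {0}" "\<forall>z\<in>- {0}. invertible (inv2 (f z))"
    using x(3,4) by (auto intro!: mat_holomorphic_inv2 invertible_inv2)
  moreover have "(\<lambda>w. inv2 (if w = 0 then L else f (1 / w))) mat_holomorphic_on UNIV"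
    using x(4-6) by (intro mat_holomorphic_inv2) auto
  then have "(\<lambda>w. if w = 0 then inv2 L else inv2 (f (1 / w))) mat_holomorphic_on UNIV"
    by (simp add: if_distrib cong: if_cong)
  ultimately show "inv\<^bsub>LGL2\<^esub> x \<in> LGL2_minus"
    unfolding x(1) germ_inv[OF x(7)] LGL2_minus_def using x(2) invertible_inv2[OF x(5)] by blast
next
  fix x y assume "x \<in> LGL2_minus" "y \<in> LGL2_minus"
  then obtain R f L S g M where x: "x = germ R f" "R > 0" "f mat_holomorphic_on - {0}"
    "\<forall>z\<in>- {0}. invertible (f z)" "invertible L"
    "(\<lambda>w. if w = 0 then L else f (1 / w)) mat_holomorphic_on UNIV" "(R, f) \<in> punctured_maps"
    and y: "y = germ S g" "S > 0" "g mat_holomorphic_on - {0}"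
    "\<forall>z\<in>- {0}. invertible (g z)" "invertible M"
    "(\<lambda>w. if w = 0 then M else g (1 / w)) mat_holomorphic_on UNIV" "(S, g) \<in> punctured_maps"
    by (elim LGL2_minusE) blast
  have "min R S > 0" "(\<lambda>z. f z ** g z) mat_holomorphic_on - {0}"
    "\<forall>z\<in>- {0}. invertible (f z ** g z)"
    using x(2-4) y(2-4) by (auto intro!: mat_holomorphic_mult invertible_mult)
  moreover have "(\<lambda>w. if w = 0 then L ** M else f (1 / w) ** g (1 / w)) =
      (\<lambda>w. (if w = 0 then L else f (1 / w)) ** (if w = 0 then M else g (1 / w)))"
    by auto
  then have "(\<lambda>w. if w = 0 then L ** M else f (1 / w) ** g (1 / w)) mat_holomorphic_on UNIV"
    using mat_holomorphic_mult[OF x(6) y(6)] by simp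
  ultimately show "x \<otimes>\<^bsub>LGL2\<^esub> y \<in> LGL2_minus"
    unfolding x(1) y(1) germ_mult[OF x(7) y(7)] LGL2_minus_def
    using invertible_mult[OF x(5) y(5)] by blast
qed

end

theory Submission
  imports Defs "HOL-Complex_Analysis.Complex_Analysis"
begin

text \<open>
  Throughout \<open>w = 1 / z\<close> denotes the coordinate at infinity, and \<open>f\<close> is rescaled so that it is
  holomorphic and invertible for \<open>0 < \<bar>z\<bar> < 4\<close>. The proof first treats matrix functions close to the
  identity, where the factorization solves a linear system with a contracting kernel, reduces the general
  case to this one by approximation, and then repairs the approximation algebraically.

  Dropping the high powers of \<open>z\<close> from the Laurent series of \<open>f\<close> gives \<open>p(z) = z\<^sup>N P(w)\<close> with \<open>P\<close>
  entire, and \<open>p f\<^sup>-\<^sup>1\<close> is as close to the identity on an annulus around the unit circle as desired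
  (\<open>Laurent_truncation\<close>). For a matrix function \<open>F\<close> close to the identity there is an \<open>X\<close> equal to the identity
  plus negative powers of \<open>z\<close> such that \<open>X F = Y\<close> has only nonnegative powers: the negative Laurent
  coefficients of \<open>X F\<close> form an infinite linear system for the coefficients of \<open>X\<close>, solved by a
  Neumann series in the space of bounded sequences, and \<open>Y\<close> is so close to the identity that it is
  invertible on a disc (\<open>near_identity_factor\<close>). Applied to \<open>F = p f\<^sup>-\<^sup>1\<close> this reads
  \<open>f = Y\<^sup>-\<^sup>1 z\<^sup>N S(w)\<close> with \<open>S = X P\<close> holomorphic for \<open>\<bar>w\<bar> < 1\<close> (\<open>scalar_factorization\<close>).

  This is the desired shape except that \<open>det S\<close> may vanish. Since \<open>f\<close> and \<open>Y\<close> are invertible on the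
  annulus, it has only finitely many zeros, all with \<open>\<bar>w\<bar> \<le> 4 / 7\<close>. At such a zero \<open>a\<close> a
  combination of the rows of \<open>S\<close> vanishes and can be divided by \<open>w - a = z\<^sup>-\<^sup>1 (1 - a z)\<close>: the
  power of \<open>z\<close> goes into the diagonal factor, and \<open>1 - a z\<close> goes into the left factor, as it has no zero on the
  disc. The row operation itself can be carried past \<open>diag(z\<^sup>m, z\<^sup>n)\<close> as a
  polynomial in \<open>z\<close> if the row that changes is the one with the larger exponent
  (\<open>clear_row_zero\<close>). After finitely many such steps \<open>S\<close> is invertible (\<open>remove_all_zeros\<close>).

  Finally \<open>S(1 / z)\<close>, so far defined for \<open>\<bar>z\<bar> > 1\<close>, continues to the punctured plane, because on the
  punctured disc the other factors and \<open>f\<close> determine it (\<open>Birkhoff_factorization_disc\<close>).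
\<close>

(* Only matrix entries are written with $ below. *)
no_notation fps_nth (infixl "$" 75)

section \<open>Laurent expansion on an annulus\<close>

lemma circle_integral_annulus_eq:
  assumes h: "h holomorphic_on {z. r < norm z \<and> norm z < s}"
    and e: "0 < e1" "r < e1" "e1 < s" "0 < e2" "r < e2" "e2 < s"
  shows "contour_integral (circlepath 0 e1) h = contour_integral (circlepath 0 e2) h"
proof (rule Cauchy_theorem_homotopic_loops[where S = "{z. r < norm z \<and> norm z < s}"])
  let ?A = "{z::complex. r < norm z \<and> norm z < s}"
  show "open ?A"
    by (intro open_Collect_conj open_Collect_less continuous_intros)
  show "homotopic_loops ?A (circlepath 0 e1) (circlepath 0 e2)"
  proof (rule homotopic_loops_linear)
    fix t :: real assume "t \<in> {0..1}"
    show "closed_segment (circlepath 0 e1 t) (circlepath 0 e2 t) \<subseteq> ?A"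
    proof
      fix x assume "x \<in> closed_segment (circlepath 0 e1 t) (circlepath 0 e2 t)"
      then obtain u where u: "0 \<le> u" "u \<le> 1"
        "x = (1 - u) *\<^sub>R circlepath 0 e1 t + u *\<^sub>R circlepath 0 e2 t"
        by (auto simp: in_segment)
      define E where "E = exp (2 * of_real pi * \<i> * of_real t)"
      have "norm E = 1" unfolding E_def by (simp add: norm_exp_eq_Re)
      have "x = of_real ((1 - u) * e1 + u * e2) * E"
        unfolding u(3) circlepath E_def by (simp add: scaleR_conv_of_real algebra_simps)
      then have "norm x = \<bar>(1 - u) * e1 + u * e2\<bar>"
        using \<open>norm E = 1\<close> by (simp only: norm_mult norm_of_real) simp
      then have nx: "norm x = (1 - u) * e1 + u * e2"
        using u e by simp
      have "(1 - u) *\<^sub>R e1 + u *\<^sub>R e2 \<in> {r<..<s}"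
        by (rule convexD) (use u e in \<open>auto\<close>)
      with nx show "x \<in> ?A" by simp
    qed
  qed auto
qed (use h in auto)

text \<open>
  The difference quotient of \<open>h\<close> at \<open>z\<close> is holomorphic on the whole annulus, so its integrals over
  the two circles agree; the term \<open>h z / (u - z)\<close> contributes \<open>2 \<pi> \<i> h z\<close> over the outer circle,
  which surrounds \<open>z\<close>, and nothing over the inner one.
\<close>
lemma Cauchy_formula_annulus:
  assumes h: "h holomorphic_on {z. r < norm z \<and> norm z < s}"
    and e: "0 < e1" "r < e1" "e1 < norm z" "norm z < e2" "e2 < s"
  shows "2 * of_real pi * \<i> * h z = contour_integral (circlepath 0 e2) (\<lambda>u. h u / (u - z))
    - contour_integral (circlepath 0 e1) (\<lambda>u. h u / (u - z))"
proof -
  let ?A = "{z::complex. r < norm z \<and> norm z < s}"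
  have op: "open ?A"
    by (intro open_Collect_conj open_Collect_less continuous_intros)
  define g where "g = (\<lambda>u. if u = z then deriv h z else (h u - h z) / (u - z))"
  have "g holomorphic_on ?A"
    unfolding g_def by (rule pole_lemma_open[OF h op])
  then have eq: "contour_integral (circlepath 0 e1) g = contour_integral (circlepath 0 e2) g"
    by (rule circle_integral_annulus_eq) (use e in auto)
  have int: "(\<lambda>u. h u / (u - z)) contour_integrable_on circlepath 0 \<rho>"
    if "r < \<rho>" "\<rho> < s" "0 < \<rho>" "\<rho> \<noteq> norm z" for \<rho>
  proof (intro contour_integrable_continuous_circlepath continuous_intros)
    show "continuous_on (path_image (circlepath 0 \<rho>)) h"
      by (rule holomorphic_on_imp_continuous_on, rule holomorphic_on_subset[OF h])
         (use that in auto)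
  qed (use that in auto)
  have int1: "(\<lambda>u. 1 / (u - z)) contour_integrable_on circlepath 0 \<rho>"
    if "0 < \<rho>" "\<rho> \<noteq> norm z" for \<rho>
    by (intro contour_integrable_continuous_circlepath continuous_intros) (use that in auto)
  have split: "contour_integral (circlepath 0 \<rho>) g =
      contour_integral (circlepath 0 \<rho>) (\<lambda>u. h u / (u - z))
      - h z * contour_integral (circlepath 0 \<rho>) (\<lambda>u. 1 / (u - z))"
    if "r < \<rho>" "\<rho> < s" "0 < \<rho>" "\<rho> \<noteq> norm z" for \<rho>
  proof -
    have "contour_integral (circlepath 0 \<rho>) g =
        contour_integral (circlepath 0 \<rho>) (\<lambda>u. h u / (u - z) - h z * (1 / (u - z)))"
      by (rule contour_integral_eq) (use that in \<open>auto simp: g_def diff_divide_distrib\<close>)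
    also have "\<dots> = contour_integral (circlepath 0 \<rho>) (\<lambda>u. h u / (u - z))
        - contour_integral (circlepath 0 \<rho>) (\<lambda>u. h z * (1 / (u - z)))"
      using int[OF that] int1[OF that(3,4)]
      by (intro contour_integral_diff contour_integrable_lmul)
    also have "contour_integral (circlepath 0 \<rho>) (\<lambda>u. h z * (1 / (u - z))) =
        h z * contour_integral (circlepath 0 \<rho>) (\<lambda>u. 1 / (u - z))"
      by (intro contour_integral_lmul int1 that)
    finally show ?thesis .
  qed
  have "((\<lambda>u. 1 / (u - z)) has_contour_integral 2 * of_real pi * \<i> * 1) (circlepath 0 e2)"
    by (rule Cauchy_integral_circlepath_simple) (use e in auto)
  then have i2: "contour_integral (circlepath 0 e2) (\<lambda>u. 1 / (u - z)) = 2 * of_real pi * \<i>"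
    by (simp add: contour_integral_unique)
  have "((\<lambda>u. 1 / (u - z)) has_contour_integral 0) (circlepath 0 e1)"
    by (rule Cauchy_theorem_disc_simple[where a = 0 and e = "norm z"])
       (use e in \<open>auto intro!: holomorphic_intros\<close>)
  then have i1: "contour_integral (circlepath 0 e1) (\<lambda>u. 1 / (u - z)) = 0"
    by (simp add: contour_integral_unique)
  show ?thesis
    using eq split[of e1] split[of e2] e i1 i2 by (simp add: algebra_simps)
qed

text \<open>
  Integrating a series term by term, with a geometric bound for the remainder. It is applied to the
  two geometric expansions of the Cauchy kernel, in powers of \<open>z / u\<close> and of \<open>u / z\<close>.
\<close>
lemma circle_integral_sums:
  assumes k: "continuous_on (sphere 0 \<rho>) k" and \<phi>: "\<And>n::nat. continuous_on (sphere 0 \<rho>) (\<phi> n)"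
    and "0 < \<rho>" "0 \<le> q" "q < 1"
    and bound: "\<And>N u. norm u = \<rho> \<Longrightarrow> norm (k u - (\<Sum>n<N. \<phi> n u)) \<le> C * q ^ N"
  shows "(\<lambda>n. contour_integral (circlepath 0 \<rho>) (\<phi> n)) sums contour_integral (circlepath 0 \<rho>) k"
proof -
  have ik: "(k has_contour_integral contour_integral (circlepath 0 \<rho>) k) (circlepath 0 \<rho>)"
    using k \<open>0 < \<rho>\<close> by (intro has_contour_integral_integral contour_integrable_continuous_circlepath) simp
  have i\<phi>: "(\<phi> n has_contour_integral contour_integral (circlepath 0 \<rho>) (\<phi> n)) (circlepath 0 \<rho>)" for n
    using \<phi> \<open>0 < \<rho>\<close> by (intro has_contour_integral_integral contour_integrable_continuous_circlepath) simp
  have "norm (of_real \<rho> :: complex) = \<rho>" using \<open>0 < \<rho>\<close> by simp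
  then have "0 \<le> C * q ^ 0"
    by (rule order_trans[OF norm_ge_zero bound])
  then have "0 \<le> C" by simp
  have le: "norm (contour_integral (circlepath 0 \<rho>) k - (\<Sum>n<N. contour_integral (circlepath 0 \<rho>) (\<phi> n)))
      \<le> C * q ^ N * (2 * pi * \<rho>)" for N
  proof (rule has_contour_integral_bound_circlepath)
    show "((\<lambda>u. k u - (\<Sum>n<N. \<phi> n u)) has_contour_integral
      contour_integral (circlepath 0 \<rho>) k - (\<Sum>n<N. contour_integral (circlepath 0 \<rho>) (\<phi> n)))
      (circlepath 0 \<rho>)"
      by (intro has_contour_integral_diff has_contour_integral_sum ik i\<phi>) auto
  qed (use bound \<open>0 < \<rho>\<close> \<open>0 \<le> C\<close> \<open>0 \<le> q\<close> in auto)
  have "(\<lambda>N. C * q ^ N * (2 * pi * \<rho>)) \<longlonglongrightarrow> C * 0 * (2 * pi * \<rho>)"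
    using assms by (intro tendsto_intros LIMSEQ_realpow_zero) auto
  then have lim0: "(\<lambda>N. C * q ^ N * (2 * pi * \<rho>)) \<longlonglongrightarrow> 0" by simp
  have "(\<lambda>N. contour_integral (circlepath 0 \<rho>) k - (\<Sum>n<N. contour_integral (circlepath 0 \<rho>) (\<phi> n)))
      \<longlonglongrightarrow> 0"
    using le by (intro Lim_null_comparison[OF _ lim0] always_eventually) blast
  from tendsto_diff[OF tendsto_const[of "contour_integral (circlepath 0 \<rho>) k"] this]
  show ?thesis unfolding sums_def by simp
qed

lemma circle_integral_outer_expansion:
  fixes h :: "complex \<Rightarrow> complex"
  assumes h: "continuous_on (sphere 0 \<rho>) h" and z: "norm z < \<rho>"
  shows "(\<lambda>n. z ^ n * contour_integral (circlepath 0 \<rho>) (\<lambda>u. h u / u ^ (n + 1))) sums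
    contour_integral (circlepath 0 \<rho>) (\<lambda>u. h u / (u - z))"
proof -
  have "0 < \<rho>" using z norm_ge_zero[of z] by linarith
  have "compact (h ` sphere 0 \<rho>)" by (intro compact_continuous_image h) simp
  then obtain M where M: "\<And>u. norm u = \<rho> \<Longrightarrow> norm (h u) \<le> M"
    using bounded_iff compact_imp_bounded by (metis imageI mem_sphere_0)
  have int: "(\<lambda>u. h u / u ^ (n + 1)) contour_integrable_on circlepath 0 \<rho>" for n
    using \<open>0 < \<rho>\<close> by (intro contour_integrable_continuous_circlepath continuous_intros) (auto simp: h)
  have "(\<lambda>n. contour_integral (circlepath 0 \<rho>) (\<lambda>u. z ^ n * (h u / u ^ (n + 1)))) sums
      contour_integral (circlepath 0 \<rho>) (\<lambda>u. h u / (u - z))"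
  proof (rule circle_integral_sums[where q = "norm z / \<rho>" and C = "M / (\<rho> - norm z)"])
    fix N u assume u: "norm (u::complex) = \<rho>"
    then have [simp]: "u \<noteq> 0" "u \<noteq> z" using z \<open>0 < \<rho>\<close> by auto
    have "(\<Sum>n<N. z ^ n * (h u / u ^ (n + 1))) = h u / u * (\<Sum>n<N. (z / u) ^ n)"
      by (simp add: sum_distrib_left power_divide field_simps)
    also have "(\<Sum>n<N. (z / u) ^ n) = (1 - (z / u) ^ N) / (1 - z / u)"
      by (subst sum_gp_strict) (auto simp: field_simps)
    finally have "h u / (u - z) - (\<Sum>n<N. z ^ n * (h u / u ^ (n + 1))) =
        h u / (u - z) - h u / u * ((1 - (z / u) ^ N) / (1 - z / u))" by simp
    also have "\<dots> = h u / (u - z) * (z / u) ^ N"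
    proof -
      have "u * (1 - z / u) = u - z" by (simp add: field_simps)
      then have "h u / u * ((1 - (z / u) ^ N) / (1 - z / u)) = h u * (1 - (z / u) ^ N) / (u - z)"
        by (metis times_divide_times_eq)
      then show ?thesis by (simp add: diff_divide_distrib algebra_simps)
    qed
    finally have "norm (h u / (u - z) - (\<Sum>n<N. z ^ n * (h u / u ^ (n + 1)))) =
        norm (h u) / norm (u - z) * (norm z / \<rho>) ^ N"
      by (simp add: norm_mult norm_divide norm_power u)
    also have "\<dots> \<le> M / (\<rho> - norm z) * (norm z / \<rho>) ^ N"
      using u z \<open>0 < \<rho>\<close> M[OF u] order_trans[OF norm_ge_zero M[OF u]] norm_triangle_ineq2[of u z]
      by (intro mult_right_mono frac_le) auto
    finally show "norm (h u / (u - z) - (\<Sum>n<N. z ^ n * (h u / u ^ (n + 1))))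
        \<le> M / (\<rho> - norm z) * (norm z / \<rho>) ^ N" .
  qed (use z \<open>0 < \<rho>\<close> h in \<open>auto intro!: continuous_intros\<close>)
  then show ?thesis
    using contour_integral_lmul[OF int] by simp
qed

lemma circle_integral_inner_expansion:
  fixes h :: "complex \<Rightarrow> complex"
  assumes h: "continuous_on (sphere 0 \<rho>) h" and z: "\<rho> < norm z" "0 < \<rho>"
  shows "(\<lambda>n. (1 / z) ^ (n + 1) * contour_integral (circlepath 0 \<rho>) (\<lambda>u. h u * u ^ n)) sums
    - contour_integral (circlepath 0 \<rho>) (\<lambda>u. h u / (u - z))"
proof -
  have [simp]: "z \<noteq> 0" using z by auto
  have "compact (h ` sphere 0 \<rho>)" by (intro compact_continuous_image h) simp
  then obtain M where M: "\<And>u. norm u = \<rho> \<Longrightarrow> norm (h u) \<le> M"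
    using bounded_iff compact_imp_bounded by (metis imageI mem_sphere_0)
  have int: "(\<lambda>u. h u * u ^ n) contour_integrable_on circlepath 0 \<rho>" for n
    using \<open>0 < \<rho>\<close> by (intro contour_integrable_continuous_circlepath continuous_intros) (auto simp: h)
  have "(\<lambda>n. contour_integral (circlepath 0 \<rho>) (\<lambda>u. (1 / z) ^ (n + 1) * (h u * u ^ n))) sums
      contour_integral (circlepath 0 \<rho>) (\<lambda>u. - (h u / (u - z)))"
  proof (rule circle_integral_sums[where q = "\<rho> / norm z" and C = "M / (norm z - \<rho>)"])
    fix N u assume u: "norm (u::complex) = \<rho>"
    then have [simp]: "u \<noteq> z" using z by auto
    have "(\<Sum>n<N. (1 / z) ^ (n + 1) * (h u * u ^ n)) = h u / z * (\<Sum>n<N. (u / z) ^ n)"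
      by (simp add: sum_distrib_left power_divide field_simps)
    also have "(\<Sum>n<N. (u / z) ^ n) = (1 - (u / z) ^ N) / (1 - u / z)"
      by (subst sum_gp_strict) (auto simp: field_simps)
    finally have "- (h u / (u - z)) - (\<Sum>n<N. (1 / z) ^ (n + 1) * (h u * u ^ n)) =
        h u / (z - u) - h u / z * ((1 - (u / z) ^ N) / (1 - u / z))"
      by (metis minus_diff_eq minus_divide_right)
    also have "\<dots> = h u / (z - u) * (u / z) ^ N"
    proof -
      have "z * (1 - u / z) = z - u" by (simp add: field_simps)
      then have "h u / z * ((1 - (u / z) ^ N) / (1 - u / z)) = h u * (1 - (u / z) ^ N) / (z - u)"
        by (metis times_divide_times_eq)
      then show ?thesis by (simp add: diff_divide_distrib algebra_simps)
    qed
    finally have "norm (- (h u / (u - z)) - (\<Sum>n<N. (1 / z) ^ (n + 1) * (h u * u ^ n))) =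
        norm (h u) / norm (z - u) * (\<rho> / norm z) ^ N"
      by (simp add: norm_mult norm_divide norm_power u)
    also have "\<dots> \<le> M / (norm z - \<rho>) * (\<rho> / norm z) ^ N"
      using u z \<open>0 < \<rho>\<close> M[OF u] order_trans[OF norm_ge_zero M[OF u]] norm_triangle_ineq2[of z u]
      by (intro mult_right_mono frac_le) auto
    finally show "norm (- (h u / (u - z)) - (\<Sum>n<N. (1 / z) ^ (n + 1) * (h u * u ^ n)))
        \<le> M / (norm z - \<rho>) * (\<rho> / norm z) ^ N" .
  qed (use z \<open>0 < \<rho>\<close> h in \<open>auto intro!: continuous_intros\<close>)
  then show ?thesis
    by (simp only: contour_integral_lmul[OF int] contour_integral_neg)
qed

text \<open>
  The coefficients are circle integrals, and these do not depend on the radius. The Cauchy estimates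
  therefore hold for all radii at once, and it is this freedom that later gives geometric decay in
  both directions and convergence of the principal part at every \<open>z \<noteq> 0\<close> when \<open>r = 0\<close>.
\<close>
lemma Laurent_expansion_annulus:
  fixes h :: "complex \<Rightarrow> complex"
  assumes h: "h holomorphic_on {z. r < norm z \<and> norm z < s}" and rs: "0 \<le> r" "r < s"
  obtains a b :: "nat \<Rightarrow> complex" where
    "\<And>\<rho> M n. \<lbrakk>r < \<rho>; \<rho> < s; \<And>u. norm u = \<rho> \<Longrightarrow> norm (h u) \<le> M\<rbrakk> \<Longrightarrow> norm (a n) \<le> M / \<rho> ^ n"
    "\<And>\<rho> M n. \<lbrakk>r < \<rho>; \<rho> < s; \<And>u. norm u = \<rho> \<Longrightarrow> norm (h u) \<le> M\<rbrakk> \<Longrightarrow> norm (b n) \<le> M * \<rho> ^ (n + 1)"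
    "\<And>z. \<lbrakk>r < norm z; norm z < s\<rbrakk> \<Longrightarrow>
       h z = (\<Sum>n. a n * z ^ n) + (\<Sum>n. b n * (1 / z) ^ (n + 1))"
proof -
  obtain c where c: "r < c" "c < s" using rs dense by blast
  define a where "a n = contour_integral (circlepath 0 c) (\<lambda>u. h u / u ^ (n + 1)) / (2 * of_real pi * \<i>)" for n
  define b where "b n = contour_integral (circlepath 0 c) (\<lambda>u. h u * u ^ n) / (2 * of_real pi * \<i>)" for n
  have cont: "continuous_on (sphere 0 \<rho>) h" if "r < \<rho>" "\<rho> < s" for \<rho>
    by (rule holomorphic_on_imp_continuous_on, rule holomorphic_on_subset[OF h]) (use that in auto)
  have a: "a n = contour_integral (circlepath 0 \<rho>) (\<lambda>u. h u / u ^ (n + 1)) / (2 * of_real pi * \<i>)"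
    if "r < \<rho>" "\<rho> < s" for n \<rho>
    unfolding a_def
    by (subst circle_integral_annulus_eq[of _ r s c \<rho>])
       (use that c rs in \<open>auto intro!: holomorphic_intros h\<close>)
  have b: "b n = contour_integral (circlepath 0 \<rho>) (\<lambda>u. h u * u ^ n) / (2 * of_real pi * \<i>)"
    if "r < \<rho>" "\<rho> < s" for n \<rho>
    unfolding b_def
    by (subst circle_integral_annulus_eq[of _ r s c \<rho>])
       (use that c rs in \<open>auto intro!: holomorphic_intros h\<close>)
  have ab: "norm (a n) \<le> M / \<rho> ^ n" "norm (b n) \<le> M * \<rho> ^ (n + 1)"
    if "r < \<rho>" "\<rho> < s" and M: "\<And>u. norm u = \<rho> \<Longrightarrow> norm (h u) \<le> M" for \<rho> M n
  proof -
    have "0 < \<rho>" using that rs by simp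
    have "norm (of_real \<rho> :: complex) = \<rho>" using \<open>0 < \<rho>\<close> by simp
    then have "0 \<le> M" using M norm_ge_zero order_trans by blast
    have bd: "norm (contour_integral (circlepath 0 \<rho>) g / (2 * of_real pi * \<i>)) \<le> B * \<rho>"
      if "continuous_on (sphere 0 \<rho>) g" "0 \<le> B" "\<And>u. norm u = \<rho> \<Longrightarrow> norm (g u) \<le> B" for g B
    proof -
      have "norm (contour_integral (circlepath 0 \<rho>) g) \<le> B * (2 * pi * \<rho>)"
        using that \<open>0 < \<rho>\<close>
        by (intro has_contour_integral_bound_circlepath[of g _ 0] has_contour_integral_integral
            contour_integrable_continuous_circlepath) auto
      then show ?thesis by (simp add: norm_divide norm_mult divide_simps mult_ac)
    qed
    have "norm (a n) \<le> M / \<rho> ^ (n + 1) * \<rho>"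
      unfolding a[OF that(1,2)] using \<open>0 < \<rho>\<close> \<open>0 \<le> M\<close> M cont[OF that(1,2)]
      by (intro bd) (auto intro!: continuous_intros divide_right_mono simp: norm_divide norm_mult norm_power)
    then show "norm (a n) \<le> M / \<rho> ^ n" using \<open>0 < \<rho>\<close> by simp
    have "norm (b n) \<le> M * \<rho> ^ n * \<rho>"
      unfolding b[OF that(1,2)] using \<open>0 < \<rho>\<close> \<open>0 \<le> M\<close> M cont[OF that(1,2)]
      by (intro bd) (auto intro!: continuous_intros mult_right_mono simp: norm_mult norm_power)
    then show "norm (b n) \<le> M * \<rho> ^ (n + 1)" by (simp add: mult_ac)
  qed
  have hz: "h z = (\<Sum>n. a n * z ^ n) + (\<Sum>n. b n * (1 / z) ^ (n + 1))" if z: "r < norm z" "norm z < s" for z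
  proof -
    obtain e1 where e1: "r < e1" "e1 < norm z" using z dense by blast
    obtain e2 where e2: "norm z < e2" "e2 < s" using z dense by blast
    let ?I = "2 * of_real pi * \<i> :: complex"
    have "(\<lambda>n. z ^ n * contour_integral (circlepath 0 e2) (\<lambda>u. h u / u ^ (n + 1)) / ?I) sums
        (contour_integral (circlepath 0 e2) (\<lambda>u. h u / (u - z)) / ?I)"
      by (intro sums_divide circle_integral_outer_expansion cont) (use e1 e2 z in auto)
    then have A: "(\<lambda>n. a n * z ^ n) sums (contour_integral (circlepath 0 e2) (\<lambda>u. h u / (u - z)) / ?I)"
      using a[of e2] e1 e2 z by (simp add: mult_ac)
    have "(\<lambda>n. (1 / z) ^ (n + 1) * contour_integral (circlepath 0 e1) (\<lambda>u. h u * u ^ n) / ?I) sums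
        (- contour_integral (circlepath 0 e1) (\<lambda>u. h u / (u - z)) / ?I)"
      by (intro sums_divide circle_integral_inner_expansion cont) (use e1 e2 z rs in auto)
    then have B: "(\<lambda>n. b n * (1 / z) ^ (n + 1)) sums
        (- contour_integral (circlepath 0 e1) (\<lambda>u. h u / (u - z)) / ?I)"
      using b[of e1] e1 e2 z by (simp add: mult_ac)
    have "h z = contour_integral (circlepath 0 e2) (\<lambda>u. h u / (u - z)) / ?I +
        (- contour_integral (circlepath 0 e1) (\<lambda>u. h u / (u - z)) / ?I)"
      using Cauchy_formula_annulus[OF h, of e1 z e2] e1 e2 rs by (simp add: field_simps)
    then show ?thesis using A B by (simp add: sums_iff)
  qed
  show ?thesis by (rule that[OF ab(1) ab(2) hz])
qed

section \<open>Linear systems and products of absolutely convergent series\<close>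

text \<open>
  The linear system \<open>x = b + K x\<close> on bounded families: a kernel whose rows have \<open>\<ell>\<^sup>1\<close> norm at most
  \<open>1 / 2\<close> is a contraction for the sup norm, and \<open>x\<close> is the Neumann series of iterated kernels
  applied to \<open>b\<close>. The index type is arbitrary so that a pair of a power and a column can serve as
  index.
\<close>
lemma kernel_fixed_point:
  fixes K :: "'i \<Rightarrow> 'i \<Rightarrow> complex"
  assumes K: "\<And>i. (\<lambda>j. norm (K i j)) summable_on UNIV" "\<And>i. (\<Sum>\<^sub>\<infinity>j. norm (K i j)) \<le> 1 / 2"
    and b: "\<And>i. norm (b i) \<le> B"
  obtains x where "\<And>i. norm (x i) \<le> 2 * B" "\<And>i. ((\<lambda>j. K i j * x j) has_sum (x i - b i)) UNIV"
proof -
  define t where "t n = ((\<lambda>y i. \<Sum>\<^sub>\<infinity>j. K i j * y j) ^^ n) b" for n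
  have t_Suc: "t (Suc n) i = (\<Sum>\<^sub>\<infinity>j. K i j * t n j)" for n i by (simp add: t_def)
  have "0 \<le> B" using b norm_ge_zero order_trans by blast
  have Ks: "(\<lambda>j. norm (K i j * y j)) summable_on UNIV \<and> norm (\<Sum>\<^sub>\<infinity>j. K i j * y j) \<le> C / 2"
    if y: "\<And>j. norm (y j) \<le> C" for i y C
  proof
    have "0 \<le> C" using y norm_ge_zero order_trans by blast
    have s: "(\<lambda>j. norm (K i j) * C) summable_on UNIV"
      by (rule summable_on_cmult_left[OF K(1)])
    have le: "norm (K i j * y j) \<le> norm (K i j) * C" for j
      using y by (simp add: norm_mult mult_left_mono)
    show abs: "(\<lambda>j. norm (K i j * y j)) summable_on UNIV"
      by (rule Infinite_Sum.abs_summable_on_comparison_test'[OF s]) (use le in auto)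
    have "norm (\<Sum>\<^sub>\<infinity>j. K i j * y j) \<le> (\<Sum>\<^sub>\<infinity>j. norm (K i j * y j))"
      by (rule norm_infsum_bound[OF abs])
    also have "\<dots> \<le> (\<Sum>\<^sub>\<infinity>j. norm (K i j) * C)"
      by (intro infsum_mono abs s le)
    also have "\<dots> = (\<Sum>\<^sub>\<infinity>j. norm (K i j)) * C"
      by (rule infsum_cmult_left) (use K in auto)
    also have "\<dots> \<le> 1 / 2 * C" by (intro mult_right_mono K \<open>0 \<le> C\<close>)
    finally show "norm (\<Sum>\<^sub>\<infinity>j. K i j * y j) \<le> C / 2" by simp
  qed
  have t_le: "norm (t n i) \<le> B * (1 / 2) ^ n" for n i
  proof (induction n arbitrary: i)
    case 0 then show ?case using b by (simp add: t_def)
  next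
    case (Suc n)
    from Ks[of "t n", OF Suc] show ?case by (simp add: t_Suc)
  qed
  have geo: "(\<lambda>n. B * (1 / 2) ^ n) sums (B * 2)"
    using sums_mult[OF geometric_sums[of "1 / 2 :: real"], of B] by simp
  have geo_sum: "(\<lambda>n. B * (1 / 2) ^ n) summable_on UNIV"
    using norm_summable_imp_has_sum[OF _ geo] sums_summable[OF geo] \<open>0 \<le> B\<close> has_sum_imp_summable by auto
  define x where "x i = (\<Sum>n. t n i)" for i
  have sum_t: "summable (\<lambda>n. norm (t n i))" for i
    by (rule summable_comparison_test'[OF sums_summable[OF geo]]) (use t_le in auto)
  have x: "(\<lambda>n. t n i) sums x i" for i
    unfolding x_def by (rule summable_sums[OF summable_norm_cancel[OF sum_t]])
  have xs: "((\<lambda>n. t n i) has_sum x i) UNIV" for i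
    by (rule norm_summable_imp_has_sum[OF sum_t x])
  have "norm (x i) \<le> 2 * B" for i
    using norm_suminf_le[OF t_le[of _ i] sums_summable[OF geo]] sums_unique[OF geo]
    by (simp add: x_def mult.commute)
  moreover have "((\<lambda>j. K i j * x j) has_sum (x i - b i)) UNIV" for i
  proof -
    let ?g = "\<lambda>(n, j). K i j * t n j"
    have "(\<lambda>(n::nat, j). B * (1 / 2) ^ n * norm (K i j)) summable_on UNIV \<times> UNIV"
    proof (rule summable_on_SigmaI)
      show "((\<lambda>j. case (n, j) of (n, j) \<Rightarrow> B * (1 / 2) ^ n * norm (K i j)) has_sum
          B * (1 / 2) ^ n * (\<Sum>\<^sub>\<infinity>j. norm (K i j))) UNIV" for n
        using K by (auto intro!: has_sum_cmult_right)
      show "(\<lambda>n. B * (1 / 2) ^ n * (\<Sum>\<^sub>\<infinity>j. norm (K i j))) summable_on UNIV"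
        by (rule summable_on_cmult_left[OF geo_sum])
    qed (use \<open>0 \<le> B\<close> in auto)
    then have "(\<lambda>p. norm (?g p)) summable_on UNIV \<times> UNIV"
      by (rule Infinite_Sum.abs_summable_on_comparison_test')
         (use t_le in \<open>auto simp: norm_mult mult.commute intro!: mult_left_mono\<close>)
    then have "?g summable_on UNIV \<times> UNIV" by (rule Infinite_Sum.abs_summable_summable)
    then obtain S where S: "(?g has_sum S) (UNIV \<times> UNIV)" by (auto simp: summable_on_def)
    have "((\<lambda>n. t (Suc n) i) has_sum S) UNIV"
    proof (rule has_sum_SigmaD[OF S])
      fix n
      have "(\<lambda>j. K i j * t n j) summable_on UNIV"
        by (rule Infinite_Sum.abs_summable_summable[OF conjunct1[OF Ks[OF t_le]]])
      then show "((\<lambda>j. case (n, j) of (n, j) \<Rightarrow> K i j * t n j) has_sum t (Suc n) i) UNIV"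
        by (simp add: t_Suc)
    qed
    then have "(\<lambda>n. t (Suc n) i) sums S" by (rule has_sum_imp_sums)
    then have "(\<lambda>n. t n i) sums (S + t 0 i)" by (subst (asm) sums_Suc_iff) simp
    then have "S = x i - b i" using sums_unique2[OF x[of i]] by (simp add: t_def)
    moreover from S have "((\<lambda>(j, n). K i j * t n j) has_sum S) (UNIV \<times> UNIV)"
      by (subst (asm) has_sum_swap) simp
    then have "((\<lambda>j. K i j * x j) has_sum S) UNIV"
      by (rule has_sum_SigmaD) (auto intro!: has_sum_cmult_right xs)
    ultimately show ?thesis by simp
  qed
  ultimately show ?thesis by (rule that)
qed

lemma has_sum_mult_product:
  fixes f :: "'a \<Rightarrow> complex" and g :: "'b \<Rightarrow> complex"
  assumes f: "(f has_sum S) A" and g: "(g has_sum T) B"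
  shows "((\<lambda>(x, y). f x * g y) has_sum S * T) (A \<times> B)"
proof (rule has_sum_SigmaI)
  show "((\<lambda>y. case (x, y) of (x, y) \<Rightarrow> f x * g y) has_sum f x * T) B" for x
    using has_sum_cmult_right[OF g] by simp
  show "((\<lambda>x. f x * T) has_sum S * T) A" by (rule has_sum_cmult_left[OF f])
  have fa: "(\<lambda>x. norm (f x)) summable_on A" and ga: "(\<lambda>y. norm (g y)) summable_on B"
    using f g has_sum_imp_summable summable_on_iff_abs_summable_on_complex by blast+
  have "(\<lambda>p. norm (case p of (x, y) \<Rightarrow> f x * g y)) summable_on A \<times> B"
  proof (subst Infinite_Sum.abs_summable_on_Sigma_iff, intro conjI ballI)
    show "(\<lambda>y. norm (case (x, y) of (x, y) \<Rightarrow> f x * g y)) summable_on B" for x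
      using summable_on_cmult_right[OF ga] by (simp add: norm_mult)
    have "(\<Sum>\<^sub>\<infinity>y\<in>B. norm (f x * g y)) = norm (f x) * (\<Sum>\<^sub>\<infinity>y\<in>B. norm (g y))" for x
      by (simp add: norm_mult infsum_cmult_right ga)
    moreover have "(\<lambda>x. norm (f x) * (\<Sum>\<^sub>\<infinity>y\<in>B. norm (g y))) summable_on A"
      by (rule summable_on_cmult_left[OF fa])
    ultimately show "(\<lambda>x. norm (\<Sum>\<^sub>\<infinity>y\<in>B. norm (case (x, y) of (x, y) \<Rightarrow> f x * g y))) summable_on A"
      by (simp add: infsum_nonneg)
  qed
  then show "(\<lambda>(x, y). f x * g y) summable_on A \<times> B" by (rule Infinite_Sum.abs_summable_summable)
qed

lemma has_sum_int_from_nat: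
  fixes f :: "int \<Rightarrow> 'a::topological_comm_monoid_add"
  assumes "((\<lambda>n. f (int n)) has_sum S) UNIV" "((\<lambda>n. f (- int n - 1)) has_sum T) UNIV"
  shows "(f has_sum (S + T)) UNIV"
proof -
  have "(f has_sum S) (range int)"
    using assms(1) by (subst has_sum_reindex) (auto simp: o_def)
  moreover have "(f has_sum T) (range (\<lambda>n. - int n - 1))"
    using assms(2) by (subst has_sum_reindex) (auto simp: o_def inj_on_def)
  moreover have "range int \<inter> range (\<lambda>n. - int n - 1) = {}" by auto
  moreover have "range int \<union> range (\<lambda>n. - int n - 1) = UNIV"
  proof (intro equalityI subset_UNIV subsetI)
    fix n :: int
    show "n \<in> range int \<union> range (\<lambda>n. - int n - 1)"
      using rangeI[of int "nat n"] rangeI[of "\<lambda>n. - int n - 1" "nat (- n - 1)"]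
      by (cases "0 \<le> n") simp_all
  qed
  ultimately show ?thesis by (metis has_sum_Un_disjoint)
qed

lemma has_sum_nat_from_int:
  fixes f :: "int \<Rightarrow> 'a::topological_comm_monoid_add"
  assumes "(f has_sum S) UNIV" "\<And>n. n < 0 \<Longrightarrow> f n = 0"
  shows "((\<lambda>n. f (int n)) has_sum S) UNIV"
proof -
  have "(f has_sum S) (range int)"
    using assms(1)
    by (subst has_sum_cong_neutral[where T = UNIV and g = f])
       (auto simp: assms(2) image_iff, metis assms(2) nonneg_int_cases not_le)
  then show ?thesis by (subst (asm) has_sum_reindex) (auto simp: o_def)
qed

lemma has_sum_half_powers: "((\<lambda>n. c * (1 / 2) ^ n) has_sum 2 * c) (UNIV :: nat set)" for c :: real
proof (rule norm_summable_imp_has_sum)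
  show "(\<lambda>n. c * (1 / 2) ^ n) sums (2 * c)"
    using sums_mult[OF geometric_sums[of "1 / 2 :: real"], of c] by (simp add: ac_simps)
  show "summable (\<lambda>n. norm (c * (1 / 2) ^ n))"
    by (simp add: abs_mult summable_mult summable_geometric)
qed

lemma has_sum_half_powers_int: "((\<lambda>n::int. (1 / 2) ^ nat \<bar>n\<bar>) has_sum (3::real)) UNIV"
proof -
  have "((\<lambda>n. (1 / 2) ^ nat \<bar>int n\<bar>) has_sum (2::real)) UNIV"
    using has_sum_half_powers[of 1] by simp
  moreover have "((\<lambda>n. (1 / 2) ^ nat \<bar>- int n - 1\<bar>) has_sum (1::real)) UNIV"
    using has_sum_half_powers[of "1 / 2"] by (simp add: nat_add_distrib)
  ultimately show ?thesis using has_sum_int_from_nat by fastforce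
qed

text \<open>
  The Cauchy product of a two-sided series with a series in negative powers: both converge
  absolutely, so the double series over \<open>(n, l)\<close> may be summed along the lines \<open>n - l - 1 = m\<close>.
\<close>
lemma Laurent_product:
  fixes a :: "int \<Rightarrow> complex" and x :: "nat \<Rightarrow> complex"
  assumes a: "\<And>n. norm (a n) \<le> \<epsilon> * (1 / 2) ^ nat \<bar>n\<bar>" and x: "\<And>l. norm (x l) \<le> B"
    and A: "((\<lambda>n. a n * z powi n) has_sum A) UNIV"
    and X: "((\<lambda>l. x l * (1 / z) ^ (l + 1)) has_sum X) UNIV" and [simp]: "z \<noteq> 0"
  shows "((\<lambda>m. (\<Sum>\<^sub>\<infinity>l. a (m + int l + 1) * x l) * z powi m) has_sum A * X) UNIV"
proof -
  have s: "(\<lambda>l. a (m + int l + 1) * x l) summable_on UNIV" for m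
  proof -
    have "(\<lambda>n. (1 / 2) ^ nat \<bar>n\<bar> :: real) summable_on range (\<lambda>l. m + int l + 1)"
      using has_sum_half_powers_int has_sum_imp_summable summable_on_subset_banach by blast
    then have "(\<lambda>l. (1 / 2) ^ nat \<bar>m + int l + 1\<bar> :: real) summable_on UNIV"
      by (subst (asm) summable_on_reindex) (auto simp: o_def inj_on_def)
    then have "(\<lambda>l. (\<epsilon> * B) * (1 / 2) ^ nat \<bar>m + int l + 1\<bar>) summable_on UNIV"
      by (rule summable_on_cmult_right)
    then have "(\<lambda>l. norm (a (m + int l + 1) * x l)) summable_on UNIV"
    proof (rule Infinite_Sum.abs_summable_on_comparison_test')
      fix l
      have "norm (a (m + int l + 1)) * norm (x l) \<le> \<epsilon> * (1 / 2) ^ nat \<bar>m + int l + 1\<bar> * B"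
        by (intro mult_mono a x norm_ge_zero order_trans[OF norm_ge_zero a])
      then show "norm (a (m + int l + 1) * x l) \<le> (\<epsilon> * B) * (1 / 2) ^ nat \<bar>m + int l + 1\<bar>"
        by (simp add: norm_mult mult_ac)
    qed
    then show ?thesis by (rule Infinite_Sum.abs_summable_summable)
  qed
  have "((\<lambda>(n, l). (a n * z powi n) * (x l * (1 / z) ^ (l + 1))) has_sum A * X) (UNIV \<times> UNIV)"
    by (rule has_sum_mult_product[OF A X])
  also have "?this \<longleftrightarrow> ((\<lambda>(m, l). (a (m + int l + 1) * x l) * z powi m) has_sum A * X) (UNIV \<times> UNIV)"
  proof (rule has_sum_reindex_bij_witness[where j = "\<lambda>(n, l). (n - int l - 1, l)" and i = "\<lambda>(m, l). (m + int l + 1, l)"])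
    fix p :: "int \<times> nat"
    obtain n l where p: "p = (n, l)" by (cases p)
    have "z powi (n - int l - 1) = z powi (n - int (l + 1))" by (simp add: algebra_simps)
    also have "\<dots> = z powi n * (1 / z) ^ (l + 1)"
      by (subst power_int_diff, simp, unfold power_int_of_nat) (simp add: power_one_over divide_inverse power_inverse)
    finally show "(case case p of (n, l) \<Rightarrow> (n - int l - 1, l) of (m, l) \<Rightarrow> (a (m + int l + 1) * x l) * z powi m) =
        (case p of (n, l) \<Rightarrow> (a n * z powi n) * (x l * (1 / z) ^ (l + 1)))"
      by (simp add: p mult_ac)
  qed auto
  finally have "((\<lambda>(m, l). (a (m + int l + 1) * x l) * z powi m) has_sum A * X) (UNIV \<times> UNIV)" .
  then show ?thesis
    by (rule has_sum_SigmaD) (use s in \<open>auto intro!: has_sum_cmult_left\<close>)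
qed

section \<open>Matrix functions close to the identity\<close>

lemma powi_negative_nat: "(z :: complex) powi (- int n - 1) = (1 / z) ^ (n + 1)"
proof -
  have "- int n - 1 = - int (n + 1)" by simp
  then have "z powi (- int n - 1) = inverse (z ^ (n + 1))"
    by (simp only: power_int_minus power_int_of_nat)
  then show ?thesis by (simp add: divide_inverse power_inverse)
qed

text \<open>
  Two-sided indexing turns products of expansions into plain convolutions. The decay comes from the
  Cauchy estimates on the circles of radius \<open>2\<close> (nonnegative powers) and \<open>1 / 2\<close> (negative powers).
\<close>
lemma Laurent_expansion_int:
  fixes h :: "complex \<Rightarrow> complex"
  assumes h: "h holomorphic_on {z. 1/3 < norm z \<and> norm z < 3}"
    and le: "\<And>z. 1/3 < norm z \<Longrightarrow> norm z < 3 \<Longrightarrow> norm (h z) \<le> \<epsilon>"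
  obtains a :: "int \<Rightarrow> complex" where
    "\<And>n. norm (a n) \<le> \<epsilon> * (1 / 2) ^ nat \<bar>n\<bar>"
    "\<And>z. \<lbrakk>1 < norm z; norm z < 2\<rbrakk> \<Longrightarrow> ((\<lambda>n. a n * z powi n) has_sum h z) UNIV"
proof -
  obtain p q where p: "\<And>\<rho> M n. \<lbrakk>1/3 < \<rho>; \<rho> < 3; \<And>u. norm u = \<rho> \<Longrightarrow> norm (h u) \<le> M\<rbrakk> \<Longrightarrow> norm (p n) \<le> M / \<rho> ^ n"
    and q: "\<And>\<rho> M n. \<lbrakk>1/3 < \<rho>; \<rho> < 3; \<And>u. norm u = \<rho> \<Longrightarrow> norm (h u) \<le> M\<rbrakk> \<Longrightarrow> norm (q n) \<le> M * \<rho> ^ (n + 1)"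
    and sum: "\<And>z. \<lbrakk>1/3 < norm z; norm z < 3\<rbrakk> \<Longrightarrow>
       h z = (\<Sum>n. p n * z ^ n) + (\<Sum>n. q n * (1 / z) ^ (n + 1))"
    using Laurent_expansion_annulus[OF h] by auto
  have p: "norm (p n) \<le> \<epsilon> * (1 / 2) ^ n" for n
    using p[of 2 \<epsilon> n] le by (simp add: power_one_over)
  have q: "norm (q n) \<le> \<epsilon> * (1 / 2) ^ (n + 1)" for n
    using q[of "1 / 2" \<epsilon> n] le by simp
  define a where "a n = (if n \<ge> 0 then p (nat n) else q (nat (- n - 1)))" for n :: int
  have a_le: "norm (a n) \<le> \<epsilon> * (1 / 2) ^ nat \<bar>n\<bar>" for n
  proof (cases "0 \<le> n")
    case False
    then have "nat \<bar>n\<bar> = nat (- n - 1) + 1" by simp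
    then show ?thesis using q[of "nat (- n - 1)"] False by (simp add: a_def)
  qed (simp add: a_def p)
  have "((\<lambda>n. a n * z powi n) has_sum h z) UNIV" if z: "1 < norm z" "norm z < 2" for z
  proof -
    have [simp]: "z \<noteq> 0" using z by auto
    have sp: "summable (\<lambda>n. norm (p n * z ^ n))"
    proof (rule summable_comparison_test')
      show "summable (\<lambda>n. \<epsilon> * (norm z / 2) ^ n)"
        using z by (intro summable_mult summable_geometric) auto
      show "norm (norm (p n * z ^ n)) \<le> \<epsilon> * (norm z / 2) ^ n" for n
        using mult_right_mono[OF p[of n], of "norm z ^ n"]
        by (simp add: norm_mult norm_power power_divide)
    qed
    have sq: "summable (\<lambda>n. norm (q n * (1 / z) ^ (n + 1)))"
    proof (rule summable_comparison_test')
      show "summable (\<lambda>n. \<epsilon> * (1 / 2) ^ (n + 1))"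
        by (intro summable_mult iffD2[OF summable_iff_shift] summable_geometric) auto
      have "norm (1 / z) ^ n \<le> 1" for n
        using z by (intro power_le_one) (auto simp: norm_divide)
      then show "norm (norm (q n * (1 / z) ^ (n + 1))) \<le> \<epsilon> * (1 / 2) ^ (n + 1)" for n
        using mult_mono[OF q[of n], of "norm (1 / z) ^ (n + 1)" 1] order_trans[OF norm_ge_zero q[of n]]
        by (simp only: norm_mult norm_power real_norm_def abs_norm_cancel) (simp add: abs_mult norm_divide)
    qed
    have "((\<lambda>n. p n * z ^ n) has_sum (\<Sum>n. p n * z ^ n)) UNIV"
      by (rule norm_summable_imp_has_sum[OF sp summable_sums[OF summable_norm_cancel[OF sp]]])
    then have "((\<lambda>n. a (int n) * z powi int n) has_sum (\<Sum>n. p n * z ^ n)) UNIV"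
      by (simp add: a_def)
    moreover have "((\<lambda>n. q n * (1 / z) ^ (n + 1)) has_sum (\<Sum>n. q n * (1 / z) ^ (n + 1))) UNIV"
      by (rule norm_summable_imp_has_sum[OF sq summable_sums[OF summable_norm_cancel[OF sq]]])
    moreover have "a (- int n - 1) * z powi (- int n - 1) = q n * (1 / z) ^ (n + 1)" for n
      unfolding powi_negative_nat by (simp add: a_def)
    ultimately show ?thesis
      using sum[of z] z has_sum_int_from_nat[of "\<lambda>n. a n * z powi n"] by simp
  qed
  with a_le show ?thesis by (rule that)
qed

text \<open>
  One row of the factorization of \<open>1 + A\<close>. Take the row \<open>r\<close> of the left factor to be the unit vector
  plus unknown series in negative powers of \<open>z\<close>, with coefficients \<open>x l i\<close>. Its product with
  \<open>1 + A\<close>, minus the unit vector, is the left-hand side of the last conclusion; it has only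
  nonnegative powers iff its coefficients of \<open>z\<close> to the power \<open>- k - 1\<close> vanish for all \<open>k\<close>. That is a linear
  system of the form \<open>x = b + K x\<close>, where \<open>K\<close> is built from the coefficients of \<open>A\<close> and is small
  because \<open>A\<close> is.
\<close>
lemma near_identity_row:
  fixes a :: "2 \<Rightarrow> 2 \<Rightarrow> int \<Rightarrow> complex" and A :: "2 \<Rightarrow> 2 \<Rightarrow> complex \<Rightarrow> complex"
  assumes a: "\<And>i j n. norm (a i j n) \<le> 1 / 100 * (1 / 2) ^ nat \<bar>n\<bar>"
    and A: "\<And>i j z. \<lbrakk>1 < norm z; norm z < 2\<rbrakk> \<Longrightarrow> ((\<lambda>n. a i j n * z powi n) has_sum A i j z) UNIV"
  obtains x :: "nat \<Rightarrow> 2 \<Rightarrow> complex" and d :: "nat \<Rightarrow> 2 \<Rightarrow> complex" where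
    "\<And>l i. norm (x l i) \<le> 1 / 50"
    "\<And>m j. norm (d m j) \<le> 1 / 90 * (1 / 2) ^ m"
    "\<And>z j. \<lbrakk>1 < norm z; norm z < 2\<rbrakk> \<Longrightarrow>
       (\<Sum>l. x l j * (1 / z) ^ (l + 1)) + A r j z + (\<Sum>i\<in>UNIV. A i j z * (\<Sum>l. x l i * (1 / z) ^ (l + 1)))
       = (\<Sum>m. d m j * z ^ m)"
proof -
  define K where "K = (\<lambda>(k, j) (l, i). - a i j (int l - int k))"
  define b where "b = (\<lambda>(k, j). - a r j (- int k - 1))"
  have hs: "((\<lambda>n. 1 / 100 * (1 / 2) ^ nat \<bar>n\<bar>) has_sum (3 / 100 :: real)) (UNIV :: int set)"
    using has_sum_cmult_right[OF has_sum_half_powers_int, of "1 / 100"] by simp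
  \<comment> \<open>The coefficients of each entry of \<open>A\<close> have \<open>\<ell>\<^sup>1\<close> norm at most \<open>3 / 100\<close>; a row of \<open>K\<close> meets two entries.\<close>
  have an: "(\<lambda>n. norm (a i j n)) summable_on UNIV" "(\<Sum>\<^sub>\<infinity>n. norm (a i j n)) \<le> 3 / 100" for i j
  proof -
    show s: "(\<lambda>n. norm (a i j n)) summable_on UNIV"
      by (rule Infinite_Sum.abs_summable_on_comparison_test'[OF has_sum_imp_summable[OF hs] a])
    have "(\<Sum>\<^sub>\<infinity>n. norm (a i j n)) \<le> (\<Sum>\<^sub>\<infinity>n. 1 / 100 * (1 / 2) ^ nat \<bar>n\<bar>)"
      by (intro infsum_mono s has_sum_imp_summable[OF hs] a)
    also have "\<dots> = 3 / 100" using hs by (rule infsumI)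
    finally show "(\<Sum>\<^sub>\<infinity>n. norm (a i j n)) \<le> 3 / 100" .
  qed
  have shift: "(\<lambda>l. norm (a i j (int l - k))) summable_on UNIV"
      "(\<Sum>\<^sub>\<infinity>l. norm (a i j (int l - k))) \<le> 3 / 100" for i j k
  proof -
    have inj: "inj (\<lambda>l. int l - k)" by (auto simp: inj_on_def)
    have s: "(\<lambda>n. norm (a i j n)) summable_on range (\<lambda>l. int l - k)"
      by (rule summable_on_subset_banach[OF an(1)]) simp
    then show "(\<lambda>l. norm (a i j (int l - k))) summable_on UNIV"
      by (subst (asm) summable_on_reindex[OF inj]) (simp add: o_def)
    have "(\<Sum>\<^sub>\<infinity>l. norm (a i j (int l - k))) = infsum (\<lambda>n. norm (a i j n)) (range (\<lambda>l. int l - k))"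
      by (subst infsum_reindex[OF inj]) (simp add: o_def)
    also have "\<dots> \<le> (\<Sum>\<^sub>\<infinity>n. norm (a i j n))"
      by (intro infsum_mono2 s an(1)) auto
    also have "\<dots> \<le> 3 / 100" by (rule an(2))
    finally show "(\<Sum>\<^sub>\<infinity>l. norm (a i j (int l - k))) \<le> 3 / 100" .
  qed
  have row: "((\<lambda>p. norm (K (k, j) p)) has_sum
      (\<Sum>i\<in>UNIV. \<Sum>\<^sub>\<infinity>l. norm (a i j (int l - int k)))) UNIV" for k j
  proof -
    have "((\<lambda>p. case p of (i, l) \<Rightarrow> norm (K (k, j) (l, i))) has_sum
        (\<Sum>i\<in>UNIV. \<Sum>\<^sub>\<infinity>l. norm (a i j (int l - int k)))) (UNIV \<times> UNIV)"
    proof (rule has_sum_SigmaI)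
      show in1: "((\<lambda>l. case (i, l) of (i, l) \<Rightarrow> norm (K (k, j) (l, i))) has_sum
          (\<Sum>\<^sub>\<infinity>l. norm (a i j (int l - int k)))) UNIV" for i
        using shift(1) by (simp add: K_def)
      show "(\<lambda>(i, l). norm (K (k, j) (l, i))) summable_on UNIV \<times> UNIV"
        by (rule summable_on_SigmaI[OF in1]) auto
    qed simp
    then show ?thesis by (subst (asm) has_sum_swap) (simp add: case_prod_unfold)
  qed
  obtain x' where x'_le: "\<And>p. norm (x' p) \<le> 2 * (1 / 100)"
    and x'_eq: "\<And>p. ((\<lambda>p'. K p p' * x' p') has_sum (x' p - b p)) UNIV"
  proof (rule kernel_fixed_point[of K b "1 / 100"])
    fix p :: "nat \<times> 2"
    obtain k j where p: "p = (k, j)" by (cases p)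
    show "(\<lambda>p'. norm (K p p')) summable_on UNIV"
      using row p has_sum_imp_summable by blast
    have "(\<Sum>\<^sub>\<infinity>p'. norm (K p p')) = (\<Sum>i\<in>UNIV. \<Sum>\<^sub>\<infinity>l. norm (a i j (int l - int k)))"
      unfolding p by (rule infsumI[OF row])
    also have "\<dots> \<le> (\<Sum>i\<in>(UNIV::2 set). 3 / 100)"
      by (intro sum_mono shift)
    finally show "(\<Sum>\<^sub>\<infinity>p'. norm (K p p')) \<le> 1 / 2" by simp
    have "norm (b p) \<le> 1 / 100 * (1 / 2) ^ nat \<bar>- int k - 1\<bar>"
      using a[of r j "- int k - 1"] by (simp add: b_def p)
    also have "\<dots> \<le> 1 / 100 * 1" by (intro mult_left_mono power_le_one) auto
    finally show "norm (b p) \<le> 1 / 100" by simp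
  qed auto
  define x where "x l i = x' (l, i)" for l i
  have x_le: "norm (x l i) \<le> 1 / 50" for l i using x'_le by (simp add: x_def)
  define c where "c i j m = (\<Sum>\<^sub>\<infinity>l. a i j (m + int l + 1) * x l i)" for i j m
  have cs: "(\<lambda>l. norm (a i j (m + int l + 1) * x l i)) summable_on UNIV" for i j m
  proof (rule Infinite_Sum.abs_summable_on_comparison_test')
    show "(\<lambda>l. norm (a i j (int l - (- m - 1))) * (1 / 50)) summable_on UNIV"
      by (rule summable_on_cmult_left[OF shift(1)])
    show "norm (a i j (m + int l + 1) * x l i) \<le> norm (a i j (int l - (- m - 1))) * (1 / 50)" for l
      using mult_left_mono[OF x_le[of l i], of "norm (a i j (m + int l + 1))"]
      by (simp add: norm_mult algebra_simps)
  qed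
  \<comment> \<open>The coefficient of the power \<open>- k - 1\<close> vanishes: this is the fixed point equation.\<close>
  have neg: "x k j + a r j (- int k - 1) + (\<Sum>i\<in>UNIV. c i j (- int k - 1)) = 0" for k j
  proof -
    have "((\<lambda>(l, i). K (k, j) (l, i) * x' (l, i)) has_sum (x' (k, j) - b (k, j))) (UNIV \<times> UNIV)"
      using x'_eq[of "(k, j)"] by (simp add: case_prod_unfold)
    then have "((\<lambda>(i, l). K (k, j) (l, i) * x' (l, i)) has_sum (x' (k, j) - b (k, j))) (UNIV \<times> UNIV)"
      by (subst (asm) has_sum_swap) (simp add: case_prod_unfold)
    then have "((\<lambda>i. - c i j (- int k - 1)) has_sum (x' (k, j) - b (k, j))) UNIV"
    proof (rule has_sum_SigmaD)
      fix i
      have "((\<lambda>l. - (a i j (- int k - 1 + int l + 1) * x l i)) has_sum - c i j (- int k - 1)) UNIV"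
        unfolding c_def
        by (intro has_sum_uminusI has_sum_infsum Infinite_Sum.abs_summable_summable[OF cs])
      then show "((\<lambda>l. case (i, l) of (i, l) \<Rightarrow> K (k, j) (l, i) * x' (l, i)) has_sum
          - c i j (- int k - 1)) UNIV"
        by (simp add: K_def x_def algebra_simps)
    qed
    then have "(\<Sum>i\<in>UNIV. - c i j (- int k - 1)) = x' (k, j) - b (k, j)"
      using has_sum_unique has_sum_finite[OF finite_class.finite_UNIV] by blast
    then have eq: "- (\<Sum>i\<in>UNIV. c i j (- int k - 1)) = x' (k, j) - b (k, j)"
      by (simp add: sum_negf)
    have "x k j + a r j (- int k - 1) = x' (k, j) - b (k, j)" by (simp add: x_def b_def)
    then show ?thesis unfolding eq[symmetric] by simp
  qed
  have c_le: "norm (c i j (int m)) \<le> 1 / 5000 * (1 / 2) ^ m" for i j m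
  proof -
    have "norm (c i j (int m)) \<le> (\<Sum>\<^sub>\<infinity>l. norm (a i j (int m + int l + 1) * x l i))"
      unfolding c_def by (rule norm_infsum_bound[OF cs])
    also have "\<dots> \<le> (\<Sum>\<^sub>\<infinity>l. (1 / 2) ^ m / 10000 * (1 / 2) ^ l)"
    proof (intro infsum_mono cs has_sum_imp_summable[OF has_sum_half_powers])
      fix l
      have "nat \<bar>int m + int l + 1\<bar> = m + l + 1" by simp
      then have "norm (a i j (int m + int l + 1)) * norm (x l i) \<le>
          1 / 100 * (1 / 2) ^ (m + l + 1) * (1 / 50)"
        by (intro mult_mono x_le order_trans[OF a]) auto
      then show "norm (a i j (int m + int l + 1) * x l i) \<le> (1 / 2) ^ m / 10000 * (1 / 2) ^ l"
        by (simp add: norm_mult power_add)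
    qed
    also have "\<dots> = 2 * ((1 / 2) ^ m / 10000)"
      by (rule infsumI[OF has_sum_half_powers])
    finally show ?thesis by simp
  qed
  \<comment> \<open>The coefficients of the remaining, nonnegative powers.\<close>
  define d where "d m j = a r j (int m) + (\<Sum>i\<in>UNIV. c i j (int m))" for m j
  have d_le: "norm (d m j) \<le> 1 / 90 * (1 / 2) ^ m" for m j
  proof -
    have "norm (d m j) \<le> norm (a r j (int m)) + (\<Sum>i\<in>UNIV. norm (c i j (int m)))"
      unfolding d_def by (intro order_trans[OF norm_triangle_ineq] add_left_mono norm_sum)
    also have "\<dots> \<le> 1 / 100 * (1 / 2) ^ m + (\<Sum>i\<in>(UNIV::2 set). 1 / 5000 * (1 / 2) ^ m)"
      using a[of r j "int m"] by (intro add_mono sum_mono c_le) auto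
    also have "\<dots> \<le> 1 / 90 * (1 / 2) ^ m" by simp
    finally show ?thesis .
  qed
  have "(\<Sum>l. x l j * (1 / z) ^ (l + 1)) + A r j z + (\<Sum>i\<in>UNIV. A i j z * (\<Sum>l. x l i * (1 / z) ^ (l + 1)))
       = (\<Sum>m. d m j * z ^ m)" if z: "1 < norm z" "norm z < 2" for z j
  proof -
    have [simp]: "z \<noteq> 0" using z by auto
    let ?X = "\<lambda>i. \<Sum>l. x l i * (1 / z) ^ (l + 1)"
    have X: "((\<lambda>l. x l i * (1 / z) ^ (l + 1)) has_sum ?X i) UNIV" for i
    proof -
      have s: "summable (\<lambda>l. norm (x l i * (1 / z) ^ (l + 1)))"
      proof (rule summable_comparison_test')
        show "summable (\<lambda>l. 1 / 50 * norm (1 / z) ^ (l + 1))"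
          using z by (intro summable_mult iffD2[OF summable_iff_shift] summable_geometric)
            (auto simp: norm_divide)
        show "norm (norm (x l i * (1 / z) ^ (l + 1))) \<le> 1 / 50 * norm (1 / z) ^ (l + 1)" for l
          unfolding real_norm_def abs_norm_cancel unfolding norm_mult norm_power by (intro mult_right_mono x_le) auto
      qed
      show ?thesis
        by (rule norm_summable_imp_has_sum[OF s summable_sums[OF summable_norm_cancel[OF s]]])
    qed
    have neg_part: "((\<lambda>m. (if m < 0 then x (nat (- m - 1)) j else 0) * z powi m) has_sum 0 + ?X j) UNIV"
    proof (rule has_sum_int_from_nat)
      show "((\<lambda>n. (if - int n - 1 < 0 then x (nat (- (- int n - 1) - 1)) j else 0) * z powi (- int n - 1))
          has_sum ?X j) UNIV"
        unfolding powi_negative_nat using X by simp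
    qed simp
    have "((\<lambda>m. (if m < 0 then x (nat (- m - 1)) j else 0) * z powi m + a r j m * z powi m
        + (\<Sum>i\<in>UNIV. c i j m * z powi m)) has_sum
        0 + ?X j + A r j z + (\<Sum>i\<in>UNIV. A i j z * ?X i)) UNIV"
      unfolding sum_2 c_def
      by (intro has_sum_add neg_part A z Laurent_product[where \<epsilon> = "1 / 100" and B = "1 / 50"]
          a x_le X) auto
    also have "(\<lambda>m. (if m < 0 then x (nat (- m - 1)) j else 0) * z powi m + a r j m * z powi m
        + (\<Sum>i\<in>UNIV. c i j m * z powi m)) =
        (\<lambda>m. ((if m < 0 then x (nat (- m - 1)) j else 0) + a r j m + (\<Sum>i\<in>UNIV. c i j m)) * z powi m)"
      by (simp add: distrib_right sum_distrib_right)
    finally have "((\<lambda>m. ((if m < 0 then x (nat (- m - 1)) j else 0) + a r j m + (\<Sum>i\<in>UNIV. c i j m)) * z powi m)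
        has_sum ?X j + A r j z + (\<Sum>i\<in>UNIV. A i j z * ?X i)) UNIV" by simp
    then have "((\<lambda>n. ((if int n < 0 then x (nat (- int n - 1)) j else 0) + a r j (int n)
        + (\<Sum>i\<in>UNIV. c i j (int n))) * z powi int n)
        has_sum ?X j + A r j z + (\<Sum>i\<in>UNIV. A i j z * ?X i)) UNIV"
    proof (rule has_sum_nat_from_int)
      fix m :: int assume "m < 0"
      with neg[of "nat (- m - 1)" j] 
      show "((if m < 0 then x (nat (- m - 1)) j else 0) + a r j m + (\<Sum>i\<in>UNIV. c i j m)) * z powi m = 0"
        by simp
    qed
    then have "((\<lambda>n. d n j * z ^ n) has_sum ?X j + A r j z + (\<Sum>i\<in>UNIV. A i j z * ?X i)) UNIV"
      by (simp add: d_def)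
    then show ?thesis using has_sum_imp_sums sums_unique by blast
  qed
  with x_le d_le show ?thesis by (rule that)
qed

lemma power_series_geometric_bound:
  fixes c :: "nat \<Rightarrow> complex"
  assumes c: "\<And>n. norm (c n) \<le> C * (1 / R) ^ n" and R: "0 < R"
  shows "(\<lambda>z. \<Sum>n. c n * z ^ n) holomorphic_on ball 0 R"
    "\<And>z. norm z < R \<Longrightarrow> summable (\<lambda>n. c n * z ^ n)"
    "\<And>z. norm z < R \<Longrightarrow> norm (\<Sum>n. c n * z ^ n) \<le> C / (1 - norm z / R)"
proof -
  have geo: "(\<lambda>n. C * (norm z / R) ^ n) sums (C / (1 - norm z / R))" if "norm z < R" for z :: complex
    using sums_mult[OF geometric_sums[of "norm z / R"], of C] R that by (simp add: divide_simps)
  have le: "norm (c n * z ^ n) \<le> C * (norm z / R) ^ n" for n z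
    using mult_right_mono[OF c[of n], of "norm z ^ n"]
    by (simp add: norm_mult norm_power power_divide)
  have "summable (\<lambda>n. norm (c n * z ^ n))" if "norm z < R" for z
    by (rule summable_comparison_test'[OF sums_summable[OF geo[OF that]]]) (use le in auto)
  then show s: "\<And>z. norm z < R \<Longrightarrow> summable (\<lambda>n. c n * z ^ n)"
    by (rule summable_norm_cancel)
  show "(\<lambda>z. \<Sum>n. c n * z ^ n) holomorphic_on ball 0 R"
  proof (rule power_series_holomorphic[where a = c and z = 0])
    show "(\<lambda>n. c n * (w - 0) ^ n) sums (\<Sum>n. c n * w ^ n)" if "w \<in> ball 0 R" for w
      using summable_sums[OF s[of w]] that by simp
  qed
  show "norm (\<Sum>n. c n * z ^ n) \<le> C / (1 - norm z / R)" if "norm z < R" for z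
    using norm_suminf_le[OF le[of _ z] sums_summable[OF geo[OF that]]] sums_unique[OF geo[OF that]]
    by simp
qed

text \<open>
  A matrix function close to the identity is, up to a factor \<open>X\<close> that is holomorphic in \<open>1 / z\<close>,
  holomorphic and invertible on the disc. The rows of \<open>X\<close> are found separately. The entries of
  \<open>Y - 1\<close> are power series with coefficients at most \<open>1 / 90\<close> times powers of \<open>1 / 2\<close>, hence small
  enough on the disc of radius \<open>7 / 4\<close> to keep \<open>det Y\<close> away from \<open>0\<close>.
\<close>
lemma near_identity_factor:
  fixes F :: "complex \<Rightarrow> cmat2"
  assumes F: "F mat_holomorphic_on {z. 1/3 < norm z \<and> norm z < 3}"
    and near: "\<And>z i j. 1/3 < norm z \<Longrightarrow> norm z < 3 \<Longrightarrow> norm (F z $ i $ j - (mat 1 :: cmat2) $ i $ j) \<le> 1 / 100"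
  obtains X Y where "X mat_holomorphic_on ball 0 1" "Y mat_holomorphic_on ball 0 (7/4)"
    "\<And>z. z \<in> ball 0 (7/4) \<Longrightarrow> invertible (Y z)"
    "\<And>z. \<lbrakk>1 < norm z; norm z < 7/4\<rbrakk> \<Longrightarrow> X (1 / z) ** F z = Y z"
proof -
  define I :: cmat2 where "I = mat 1"
  have I: "I $ i $ j = (if i = j then 1 else 0)" for i j by (simp add: I_def mat_def)
  define A where "A i j z = F z $ i $ j - I $ i $ j" for i j z
  have "\<exists>a. (\<forall>n. norm (a n) \<le> 1 / 100 * (1 / 2) ^ nat \<bar>n\<bar>) \<and>
      (\<forall>z. 1 < norm z \<longrightarrow> norm z < 2 \<longrightarrow> ((\<lambda>n. a n * z powi n) has_sum A i j z) UNIV)" for i j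
  proof -
    have "A i j holomorphic_on {z. 1/3 < norm z \<and> norm z < 3}"
      using F unfolding A_def mat_holomorphic_on_def by (intro holomorphic_intros) auto
    then obtain a where "\<And>n. norm (a n) \<le> 1 / 100 * (1 / 2) ^ nat \<bar>n\<bar>"
      "\<And>z. \<lbrakk>1 < norm z; norm z < 2\<rbrakk> \<Longrightarrow> ((\<lambda>n. a n * z powi n) has_sum A i j z) UNIV"
      by (rule Laurent_expansion_int[of "A i j" "1 / 100"]) (use near in \<open>auto simp: A_def I_def\<close>)
    then show ?thesis by blast
  qed
  then obtain a where a: "\<And>i j n. norm (a i j n) \<le> 1 / 100 * (1 / 2) ^ nat \<bar>n\<bar>"
    "\<And>i j z. 1 < norm z \<Longrightarrow> norm z < 2 \<Longrightarrow> ((\<lambda>n. a i j n * z powi n) has_sum A i j z) UNIV"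
    by metis
  define Q where "Q r x d \<longleftrightarrow> (\<forall>l i. norm (x l i) \<le> 1 / 50) \<and>
     (\<forall>m j. norm (d m j) \<le> 1 / 90 * (1 / 2) ^ m) \<and>
     (\<forall>z j. 1 < norm z \<longrightarrow> norm z < 2 \<longrightarrow>
       (\<Sum>l. x l j * (1 / z) ^ (l + 1)) + A r j z + (\<Sum>i\<in>UNIV. A i j z * (\<Sum>l. x l i * (1 / z) ^ (l + 1)))
       = (\<Sum>m. d m j * z ^ m))" for r and x d :: "nat \<Rightarrow> 2 \<Rightarrow> complex"
  have "\<exists>x d. Q r x d" for r
    unfolding Q_def by (rule near_identity_row[where a = a and A = A and r = r, OF a]) blast+
  then obtain x d where Q: "\<And>r. Q r (x r) (d r)" by metis
  have x: "norm (x r l i) \<le> 1 / 50" and d: "norm (d r m j) \<le> 1 / 90 * (1 / 2) ^ m" for r l i m j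
    using Q[of r] by (simp_all add: Q_def)
  have eq: "(\<Sum>l. x r l j * (1 / z) ^ (l + 1)) + A r j z + (\<Sum>i\<in>UNIV. A i j z * (\<Sum>l. x r l i * (1 / z) ^ (l + 1)))
       = (\<Sum>m. d r m j * z ^ m)" if "1 < norm z" "norm z < 2" for r z j
    using Q[of r] that unfolding Q_def by blast
  define X :: "complex \<Rightarrow> cmat2" where "X w = (\<chi> r i. I $ r $ i + (\<Sum>l. x r l i * w ^ l) * w)" for w
  define Y :: "complex \<Rightarrow> cmat2" where "Y z = (\<chi> r j. I $ r $ j + (\<Sum>m. d r m j * z ^ m))" for z
  have x1: "norm (x r l i) \<le> 1 / 50 * (1 / 1) ^ l" for r l i using x by simp
  have "X mat_holomorphic_on ball 0 1"
    unfolding mat_holomorphic_on_def X_def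
    by (auto intro!: holomorphic_intros power_series_geometric_bound(1)[OF x1])
  moreover have "Y mat_holomorphic_on ball 0 (7/4)"
    unfolding mat_holomorphic_on_def Y_def
    by (auto intro!: holomorphic_intros holomorphic_on_subset[OF power_series_geometric_bound(1)[OF d]])
  moreover have "invertible (Y z)" if "z \<in> ball 0 (7/4)" for z
  proof -
    define e where "e r j = (\<Sum>m. d r m j * z ^ m)" for r j
    \<comment> \<open>For \<open>\<bar>z\<bar> < 7 / 4\<close> we have \<open>1 - \<bar>z\<bar> / 2 \<ge> 1 / 8\<close>.\<close>
    have e: "norm (e r j) \<le> 1 / 4" for r j
    proof -
      have "norm (e r j) \<le> 1 / 90 / (1 - norm z / 2)"
        unfolding e_def by (rule power_series_geometric_bound(3)[OF d]) (use that in auto)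
      also have "\<dots> \<le> 1 / 90 / (1 / 8)" using that by (intro divide_left_mono) auto
      finally show ?thesis by simp
    qed
    have "det (Y z) = 1 + (e 1 1 + e 2 2 + e 1 1 * e 2 2 - e 1 2 * e 2 1)"
      by (simp add: det_2 Y_def I e_def algebra_simps)
    moreover have "norm (e 1 1 + e 2 2 + e 1 1 * e 2 2 - e 1 2 * e 2 1) \<le> 1 / 4 + 1 / 4 + 1 / 4 * (1 / 4) + 1 / 4 * (1 / 4)"
      by (intro order_trans[OF norm_triangle_ineq4] order_trans[OF norm_triangle_ineq] add_mono e)
         (auto simp: norm_mult intro!: mult_mono[OF e e, simplified])
    ultimately have "det (Y z) \<noteq> 0"
      by (auto simp: add_eq_0_iff)
    then show ?thesis by (simp add: invertible_det_nz)
  qed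
  moreover have "X (1 / z) ** F z = Y z" if z: "1 < norm z" "norm z < 7/4" for z
  proof -
    define u where "u r i = (\<Sum>l. x r l i * (1 / z) ^ (l + 1))" for r i
    have "summable (\<lambda>l. x r l i * (1 / z) ^ l)" for r i
      by (rule power_series_geometric_bound(2)[OF x1]) (use z in \<open>auto simp: norm_divide divide_less_eq_1\<close>)
    from suminf_mult2[OF this, of _ _ "1 / z"] have Xu: "X (1 / z) $ r $ i = I $ r $ i + u r i" for r i
      by (simp add: X_def u_def mult_ac)
    have FA: "F z $ i $ j = I $ i $ j + A i j z" for i j by (simp add: A_def)
    have Yu: "Y z $ r $ j = I $ r $ j + (u r j + A r j z + (A 1 j z * u r 1 + A 2 j z * u r 2))" for r j
      using eq[of z r j] z by (simp add: Y_def u_def sum_2)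
    show ?thesis
      unfolding vec_eq_iff mat_mult_nth Xu FA Yu forall_2 by (simp add: I algebra_simps)
  qed
  ultimately show ?thesis by (rule that)
qed


section \<open>Approximation by functions with a pole at infinity\<close>

text \<open>
  Dropping the high powers from the Laurent series of \<open>h\<close> leaves a uniformly close function that has at
  worst a pole at infinity: the whole principal part is retained, and after division by \<open>z ^ N\<close> the truncation
  becomes an entire function of \<open>1 / z\<close>.
\<close>
lemma Laurent_truncation:
  fixes h :: "complex \<Rightarrow> complex"
  assumes h: "h holomorphic_on ball 0 4 - {0}" and "0 < \<eta>"
  shows "\<forall>\<^sub>F N in sequentially. \<exists>P. P holomorphic_on UNIV \<and>
    (\<forall>z. 1/3 < norm z \<longrightarrow> norm z < 3 \<longrightarrow> norm (z ^ N * P (1 / z) - h z) \<le> \<eta>)"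
proof -
  have "ball 0 4 - {0} = {z::complex. 0 < norm z \<and> norm z < 4}" by auto
  with h have h': "h holomorphic_on {z. 0 < norm z \<and> norm z < 4}" by simp
  obtain a b where a: "\<And>\<rho> M n. \<lbrakk>0 < \<rho>; \<rho> < 4; \<And>u. norm u = \<rho> \<Longrightarrow> norm (h u) \<le> M\<rbrakk> \<Longrightarrow> norm (a n) \<le> M / \<rho> ^ n"
    and b: "\<And>\<rho> M n. \<lbrakk>0 < \<rho>; \<rho> < 4; \<And>u. norm u = \<rho> \<Longrightarrow> norm (h u) \<le> M\<rbrakk> \<Longrightarrow> norm (b n) \<le> M * \<rho> ^ (n + 1)"
    and sum: "\<And>z. \<lbrakk>0 < norm z; norm z < 4\<rbrakk> \<Longrightarrow>
       h z = (\<Sum>n. a n * z ^ n) + (\<Sum>n. b n * (1 / z) ^ (n + 1))"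
    by (rule Laurent_expansion_annulus[OF h'], simp, simp) blast
  have bounded: "\<exists>M. \<forall>u. norm u = \<rho> \<longrightarrow> norm (h u) \<le> M" if "0 < \<rho>" "\<rho> < 4" for \<rho>
  proof -
    have "continuous_on (sphere 0 \<rho>) h"
      by (rule holomorphic_on_imp_continuous_on, rule holomorphic_on_subset[OF h]) (use that in auto)
    then have "compact (h ` sphere 0 \<rho>)" by (intro compact_continuous_image) auto
    then show ?thesis using bounded_iff compact_imp_bounded by (metis imageI mem_sphere_0)
  qed
  \<comment> \<open>A circle between the annulus \<open>\<bar>z\<bar> < 3\<close> and the boundary \<open>\<bar>z\<bar> = 4\<close> makes the tail decay like \<open>(6 / 7) ^ N\<close>.\<close>
  obtain M where M: "\<And>u. norm u = 7/2 \<Longrightarrow> norm (h u) \<le> M" using bounded[of "7/2"] by auto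
  have a_le: "norm (a n) \<le> M * (1 / (7/2)) ^ n" for n
    using a[of "7/2" M n] M by (simp add: power_divide)
  \<comment> \<open>Small circles make the coefficients \<open>b n\<close> decay faster than any geometric sequence.\<close>
  have b_hol: "(\<lambda>w. \<Sum>n. b n * w ^ n) holomorphic_on ball 0 R" if "1 < R" for R
  proof -
    have "0 < 1 / R" "1 / R < 4" using that by (simp_all add: divide_simps)
    from bounded[OF this] obtain B where "\<And>u. norm u = 1 / R \<Longrightarrow> norm (h u) \<le> B" by blast
    then have "norm (b n) \<le> (B * (1 / R)) * (1 / R) ^ n" for n
      using b[of "1 / R" B n] that by (simp add: mult_ac divide_simps)
    then show ?thesis by (rule power_series_geometric_bound(1)) (use that in simp)
  qed
  have b_entire: "(\<lambda>w. \<Sum>n. b n * w ^ n) holomorphic_on UNIV"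
  proof -
    have "(\<lambda>w. \<Sum>n. b n * w ^ n) field_differentiable at w" for w
    proof (rule holomorphic_on_imp_differentiable_at[OF b_hol[of "norm w + 2"]])
      show "1 < norm w + 2" using norm_ge_zero[of w] by linarith
    qed auto
    then show ?thesis by (simp add: holomorphic_on_def)
  qed
  have "(\<lambda>N. M * (6/7) ^ N * 7) \<longlonglongrightarrow> M * 0 * 7"
    by (intro tendsto_intros LIMSEQ_realpow_zero) auto
  then have "\<forall>\<^sub>F N in sequentially. M * (6/7) ^ N * 7 < \<eta>"
    by (rule order_tendstoD(2)) (use \<open>0 < \<eta>\<close> in simp)
  then show ?thesis
  proof (rule eventually_mono, intro exI conjI allI impI)
    fix N assume N: "M * (6/7) ^ N * 7 < \<eta>"
    let ?P = "\<lambda>w. (\<Sum>n<N. a n * w ^ (N - n)) + w ^ N * ((\<Sum>n. b n * w ^ n) * w)"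
    show "?P holomorphic_on UNIV" by (intro holomorphic_intros b_entire)
    fix z :: complex assume z: "1/3 < norm z" "norm z < 3"
    then have [simp]: "z \<noteq> 0" by auto
    obtain B where "\<And>u. norm u = 1/3 \<Longrightarrow> norm (h u) \<le> B" using bounded[of "1/3"] by auto
    then have "norm (b n) \<le> (B * (1 / 3)) * (1 / 3) ^ n" for n
      using b[of "1/3" B n] by simp
    then have "summable (\<lambda>n. b n * (1 / z) ^ n)"
      by (rule power_series_geometric_bound(2)) (use z in \<open>auto simp: norm_divide field_simps\<close>)
    from suminf_mult2[OF this, of "1 / z"]
    have b_eq: "(\<Sum>n. b n * (1 / z) ^ n) * (1 / z) = (\<Sum>n. b n * (1 / z) ^ (n + 1))"
      by (simp add: mult_ac)
    have sa: "summable (\<lambda>n. a n * z ^ n)"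
      by (rule power_series_geometric_bound(2)[OF a_le]) (use z in auto)
    have zN: "z ^ N * (1 / z) ^ (N - n) = z ^ n" if "n < N" for n
    proof -
      have "z ^ N = z ^ n * z ^ (N - n)" using that by (simp flip: power_add)
      then show ?thesis by (simp add: power_one_over)
    qed
    have zN': "z ^ N * ((1 / z) ^ N * v) = v" for v by (simp add: power_one_over)
    have "z ^ N * ?P (1 / z) = (\<Sum>n<N. a n * z ^ n) + (\<Sum>n. b n * (1 / z) ^ (n + 1))"
      unfolding distrib_left b_eq sum_distrib_left zN'
      by (intro arg_cong2[of _ _ _ _ "(+)"] sum.cong refl) (simp add: zN mult.left_commute)
    also have "\<dots> = h z - (\<Sum>n. a (n + N) * z ^ (n + N))"
      using sum[of z] z suminf_split_initial_segment[OF sa, of N] by (simp add: algebra_simps)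
    finally have "z ^ N * ?P (1 / z) - h z = - (\<Sum>n. (a (n + N) * z ^ N) * z ^ n)"
      by (simp add: power_add mult_ac)
    also have "norm \<dots> \<le> M * (6/7) ^ N / (1 - norm z / (7/2))"
      unfolding norm_minus_cancel
    proof (rule power_series_geometric_bound(3))
      fix n
      have "norm (a (n + N)) * norm z ^ N \<le> M * (1 / (7/2)) ^ (n + N) * 3 ^ N"
        using z by (intro mult_mono a_le power_mono order_trans[OF norm_ge_zero a_le]) auto
      also have "\<dots> = M * ((1 / (7/2)) * 3) ^ N * (1 / (7/2)) ^ n"
        unfolding power_mult_distrib power_add by (simp only: mult_ac)
      finally show "norm (a (n + N) * z ^ N) \<le> M * (6/7) ^ N * (1 / (7/2)) ^ n"
        by (simp add: norm_mult norm_power)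
    qed (use z in auto)
    also have "\<dots> \<le> M * (6/7) ^ N / (1 / 7)"
      using z order_trans[OF norm_ge_zero a_le[of 0]] by (intro divide_left_mono) auto
    also have "\<dots> \<le> \<eta>" using N by simp
    finally show "norm (z ^ N * ?P (1 / z) - h z) \<le> \<eta>" .
  qed
qed

lemma mat_holomorphic_compose:
  assumes "f mat_holomorphic_on T" "g holomorphic_on S" "g ` S \<subseteq> T"
  shows "(\<lambda>z. f (g z)) mat_holomorphic_on S"
  using assms holomorphic_on_compose_gen[of g S _ T]
  unfolding mat_holomorphic_on_def o_def by blast

lemma mat_holomorphic_transform:
  assumes "f mat_holomorphic_on S" "\<And>z. z \<in> S \<Longrightarrow> f z = g z"
  shows "g mat_holomorphic_on S"
  using assms unfolding mat_holomorphic_on_def by (metis (no_types, lifting) holomorphic_transform)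

lemma mat_holomorphic_Un:
  assumes "f mat_holomorphic_on S" "f mat_holomorphic_on T" "open S" "open T"
  shows "f mat_holomorphic_on S \<union> T"
  using assms unfolding mat_holomorphic_on_def by (auto intro!: holomorphic_on_Un)

lemma Laurent_truncation_mat:
  fixes f :: "complex \<Rightarrow> cmat2"
  assumes f: "f mat_holomorphic_on ball 0 4 - {0}" and "0 < \<eta>"
  obtains N :: nat and P :: "complex \<Rightarrow> cmat2" where "P mat_holomorphic_on UNIV"
    "\<And>z i j. \<lbrakk>1/3 < norm z; norm z < 3\<rbrakk> \<Longrightarrow> norm (z ^ N * P (1 / z) $ i $ j - f z $ i $ j) \<le> \<eta>"
proof -
  define Q where "Q N i j P \<longleftrightarrow> P holomorphic_on UNIV \<and>
    (\<forall>z. 1/3 < norm z \<longrightarrow> norm z < 3 \<longrightarrow> norm (z ^ N * P (1 / z) - f z $ i $ j) \<le> \<eta>)" for N i j P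
  have "\<forall>\<^sub>F N in sequentially. \<exists>P. Q N i j P" for i j
    unfolding Q_def using f \<open>0 < \<eta>\<close> by (intro Laurent_truncation) (auto simp: mat_holomorphic_on_def)
  then have "\<forall>\<^sub>F N in sequentially. \<forall>i j. \<exists>P. Q N i j P"
    unfolding forall_2 by (intro eventually_conj)
  then obtain N where "\<forall>i j. \<exists>P. Q N i j P"
    using eventually_happens' trivial_limit_sequentially by blast
  then obtain P where "\<And>i j. Q N i j (P i j)" by metis
  then show ?thesis
    by (intro that[of "\<lambda>w. \<chi> i j. P i j w" N]) (auto simp: Q_def mat_holomorphic_on_def)
qed

section \<open>Removing the zeros of the determinant\<close>

lemma holomorphic_divide_linear:
  assumes "g holomorphic_on S" "open S" "g a = 0"
  obtains k where "k holomorphic_on S" "\<And>w. w \<in> S \<Longrightarrow> g w = (w - a) * k w"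
  by (rule that[OF pole_lemma_open[OF assms(1,2), of a]]) (use assms(3) in auto)

text \<open>
  Dividing by \<open>(w - a) ^ n\<close>, with \<open>n\<close> the order of the zero \<open>a\<close>, leaves a function that is holomorphic
  across \<open>a\<close> and has one zero less. The list \<open>as\<close> records zeros with multiplicity.
\<close>
lemma holomorphic_finite_zeros_factor:
  assumes "finite Z" and S: "open S" "connected S"
    and "\<delta> holomorphic_on S" "\<And>w. w \<in> S \<Longrightarrow> \<delta> w = 0 \<longleftrightarrow> w \<in> Z" "Z \<subseteq> S" "Z \<noteq> S"
  obtains as u where "set as \<subseteq> Z" "u holomorphic_on S" "\<And>w. w \<in> S \<Longrightarrow> u w \<noteq> 0"
    "\<And>w. w \<in> S \<Longrightarrow> \<delta> w = (\<Prod>a\<leftarrow>as. w - a) * u w"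
proof -
  have "\<exists>as u. set as \<subseteq> Z \<and> u holomorphic_on S \<and> (\<forall>w\<in>S. u w \<noteq> 0) \<and>
      (\<forall>w\<in>S. \<delta> w = (\<Prod>a\<leftarrow>as. w - a) * u w)"
    using assms(1,4-7)
  proof (induction Z arbitrary: \<delta> rule: finite_induct)
    case empty
    then show ?case by (intro exI[of _ "[]"] exI[of _ \<delta>]) auto
  next
    case (insert a Z)
    have a: "a \<in> S" "\<delta> a = 0" using insert.prems by auto
    obtain w0 where w0: "w0 \<in> S" "\<delta> w0 \<noteq> 0" using insert.prems by blast
    have nc: "\<not> \<delta> constant_on S" unfolding constant_on_def using a w0 by metis
    obtain g r n where g: "0 < n" "0 < r" "ball a r \<subseteq> S" "g holomorphic_on ball a r"
      "\<And>w. w \<in> ball a r \<Longrightarrow> \<delta> w = (w - a) ^ n * g w" "\<And>w. w \<in> ball a r \<Longrightarrow> g w \<noteq> 0"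
    proof (rule holomorphic_factor_zero_nonconstant[OF insert.prems(1) S a nc])
    qed (rule that)
    define G where "G w = (if w = a then g a else \<delta> w / (w - a) ^ n)" for w
    have "G holomorphic_on ball a r"
      by (rule holomorphic_transform[OF g(4)]) (auto simp: G_def g(5))
    moreover have "(\<lambda>w. \<delta> w / (w - a) ^ n) holomorphic_on S - {a}"
      by (intro holomorphic_intros holomorphic_on_subset[OF insert.prems(1)]) auto
    then have "G holomorphic_on S - {a}"
      by (rule holomorphic_transform) (auto simp: G_def)
    ultimately have "G holomorphic_on ball a r \<union> (S - {a})"
      using S by (intro holomorphic_on_Un) auto
    moreover have "ball a r \<union> (S - {a}) = S" using g(2,3) a by auto
    ultimately have G: "G holomorphic_on S" by simp
    have "g a \<noteq> 0" using g by auto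
    have G0: "G w = 0 \<longleftrightarrow> w \<in> Z" if "w \<in> S" for w
      using that insert.prems(2)[OF that] insert.hyps(2) \<open>g a \<noteq> 0\<close> by (auto simp: G_def)
    have "Z \<subseteq> S" "Z \<noteq> S" using insert.prems(3) insert.hyps(2) a(1) by auto
    then obtain as u where as: "set as \<subseteq> Z" "u holomorphic_on S" "\<forall>w\<in>S. u w \<noteq> 0"
      "\<forall>w\<in>S. G w = (\<Prod>a\<leftarrow>as. w - a) * u w"
      using insert.IH[OF G G0] by metis
    have "(\<Prod>b\<leftarrow>replicate n a @ as. w - b) = (w - a) ^ n * (\<Prod>b\<leftarrow>as. w - b)" for w
      by (induction n) auto
    moreover have "\<delta> w = (w - a) ^ n * G w" if "w \<in> S" for w
      using a(2) g(1) by (simp add: G_def)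
    ultimately show ?case
      using as by (intro exI[of _ "replicate n a @ as"] exI[of _ u]) auto
  qed
  then show ?thesis using that by blast
qed

lemma left_null_vector:
  fixes A :: cmat2
  assumes "det A = 0"
  obtains v1 v2 where "v1 \<noteq> 0 \<or> v2 \<noteq> 0" "\<And>j. v1 * A $ 1 $ j + v2 * A $ 2 $ j = 0"
proof -
  have d: "A $ 1 $ 1 * A $ 2 $ 2 = A $ 1 $ 2 * A $ 2 $ 1" using assms by (simp add: det_2)
  have "\<exists>v1 v2. (v1 \<noteq> 0 \<or> v2 \<noteq> 0) \<and> (\<forall>j. v1 * A $ 1 $ j + v2 * A $ 2 $ j = 0)"
  proof (cases "A $ 1 $ 1 = 0 \<and> A $ 2 $ 1 = 0")
    case True
    show ?thesis
    proof (cases "A $ 1 $ 2 = 0 \<and> A $ 2 $ 2 = 0")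
      case True
      with \<open>A $ 1 $ 1 = 0 \<and> A $ 2 $ 1 = 0\<close> show ?thesis
        by (intro exI[of _ 1]) (simp add: forall_2)
    next
      case False
      with True show ?thesis
        by (intro exI[of _ "A $ 2 $ 2"] exI[of _ "- A $ 1 $ 2"]) (auto simp: forall_2)
    qed
  next
    case False
    then show ?thesis
      using d by (intro exI[of _ "A $ 2 $ 1"] exI[of _ "- A $ 1 $ 1"]) (auto simp: forall_2 algebra_simps)
  qed
  then show ?thesis using that by blast
qed

lemma vector_2_nth: "(vector [vector [a, b], vector [c, d]] :: cmat2) $ 1 $ 1 = a"
  "(vector [vector [a, b], vector [c, d]] :: cmat2) $ 1 $ 2 = b"
  "(vector [vector [a, b], vector [c, d]] :: cmat2) $ 2 $ 1 = c"
  "(vector [vector [a, b], vector [c, d]] :: cmat2) $ 2 $ 2 = d"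
  by simp_all

text \<open>
  \<open>Y\<close> is a function of \<open>z\<close> near \<open>0\<close>, while \<open>S\<close> is a function of the coordinate \<open>w = 1 / z\<close> near
  infinity; the two domains overlap in the annulus \<open>1 < \<bar>z\<bar> < \<rho>\<close>. There are no conditions on \<open>det S\<close>: its
  zeros are removed at the expense of the exponents \<open>m\<close> and \<open>n\<close>.
\<close>
definition factors_as ::
  "real \<Rightarrow> (complex \<Rightarrow> cmat2) \<Rightarrow> (complex \<Rightarrow> cmat2) \<Rightarrow> int \<Rightarrow> int \<Rightarrow> (complex \<Rightarrow> cmat2) \<Rightarrow> bool" where
  "factors_as \<rho> f Y m n S \<longleftrightarrow>
     Y mat_holomorphic_on ball 0 \<rho> \<and> (\<forall>z\<in>ball 0 \<rho>. invertible (Y z)) \<and> S mat_holomorphic_on ball 0 1 \<and>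
     (\<forall>z. 1 < norm z \<longrightarrow> norm z < \<rho> \<longrightarrow> f z = Y z ** diag_powi m n z ** S (1 / z))"

text \<open>
  Conjugation by a quarter turn exchanges the two exponents. The turn has determinant \<open>1\<close>, so
  \<open>det S\<close> is unchanged.
\<close>
lemma factors_as_swap:
  assumes "factors_as \<rho> f Y m n S"
  defines "J \<equiv> vector [vector [0, 1], vector [- 1, 0]] :: cmat2"
  shows "factors_as \<rho> f (\<lambda>z. Y z ** inv2 J) n m (\<lambda>w. J ** S w)"
proof -
  have J: "det J = 1" unfolding det_2 J_def vector_2_nth by simp
  then have inv: "invertible J" by (simp add: invertible_det_nz)
  have "diag_powi m n z = inv2 J ** diag_powi n m z ** J" for z
    unfolding vec_eq_iff forall_2 mat_mult_nth inv2_def J diag_powi_def vector_2_nth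
    by (simp add: J_def)
  then have "Y z ** inv2 J ** diag_powi n m z ** (J ** S (1 / z)) = Y z ** diag_powi m n z ** S (1 / z)" for z
    by (simp add: matrix_mul_assoc)
  then show ?thesis
    using assms(1) unfolding factors_as_def
    by (auto intro!: mat_holomorphic_mult mat_holomorphic_const invertible_mult invertible_inv2 inv)
qed

text \<open>
  The elementary step that removes one zero \<open>a\<close> of \<open>det S\<close>. Suppose that the combination
  \<open>c * row 1 + row 2\<close> of \<open>S\<close> vanishes at \<open>a\<close>; replace row 2 by this combination divided by \<open>w - a\<close>.
  With \<open>w = 1 / z\<close> we have \<open>w - a = (1 - a * z) / z\<close>. The factor \<open>1 / z\<close> lowers the exponent \<open>n\<close>,
  and \<open>1 - a * z\<close> has no zero for \<open>\<bar>z\<bar> < \<rho>\<close> and goes into \<open>Y\<close>. Moving the row operation to the left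
  of the diagonal turns \<open>c\<close> into \<open>c * z ^ (n - m)\<close>, which is holomorphic at \<open>0\<close> if \<open>m \<le> n\<close>.
\<close>
lemma clear_row_zero:
  fixes S :: "complex \<Rightarrow> cmat2"
  assumes fac: "factors_as \<rho> f Y m n S" and a: "norm a < 1" "norm a * \<rho> \<le> 1"
    and row: "\<And>j. c * S a $ 1 $ j + S a $ 2 $ j = 0" and c: "c = 0 \<or> m \<le> n"
  obtains Y' m' n' S' where "factors_as \<rho> f Y' m' n' S'"
    "\<And>w. w \<in> ball 0 1 \<Longrightarrow> det (S w) = (w - a) * det (S' w)"
proof -
  have S: "(\<lambda>w. S w $ i $ j) holomorphic_on ball 0 1" for i j
    using fac by (auto simp: factors_as_def mat_holomorphic_on_def)
  have "\<exists>k. k holomorphic_on ball 0 1 \<and>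
      (\<forall>w\<in>ball 0 1. c * S w $ 1 $ j + S w $ 2 $ j = (w - a) * k w)" for j
    by (rule holomorphic_divide_linear[of "\<lambda>w. c * S w $ 1 $ j + S w $ 2 $ j" "ball 0 1" a])
       (use row in \<open>auto intro!: holomorphic_intros S\<close>)
  then obtain k where k: "\<And>j. k j holomorphic_on ball 0 1"
    "\<And>j w. w \<in> ball 0 1 \<Longrightarrow> c * S w $ 1 $ j + S w $ 2 $ j = (w - a) * k j w"
    by metis
  define S' :: "complex \<Rightarrow> cmat2" where
    "S' w = vector [vector [S w $ 1 $ 1, S w $ 1 $ 2], vector [k 1 w, k 2 w]]" for w
  define M :: "complex \<Rightarrow> cmat2" where
    "M z = vector [vector [1, 0], vector [- c * z ^ nat (n - m), 1 - a * z]]" for z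
  have "det (S w) = (w - a) * det (S' w)" if "w \<in> ball 0 1" for w
  proof -
    have r2: "S w $ 2 $ j = (w - a) * k j w - c * S w $ 1 $ j" for j
      using k(2)[OF that, of j] by (simp add: algebra_simps)
    show ?thesis unfolding det_2 S'_def vector_2_nth r2 by (simp add: algebra_simps)
  qed
  moreover have "factors_as \<rho> f (\<lambda>z. Y z ** M z) m (n - 1) S'"
    unfolding factors_as_def
  proof (intro conjI ballI allI impI)
    show "(\<lambda>z. Y z ** M z) mat_holomorphic_on ball 0 \<rho>"
    proof (rule mat_holomorphic_mult)
      show "M mat_holomorphic_on ball 0 \<rho>"
        unfolding mat_holomorphic_on_def forall_2 M_def vector_2_nth
        by (intro conjI holomorphic_intros)
    qed (use fac in \<open>simp add: factors_as_def\<close>)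
    show "S' mat_holomorphic_on ball 0 1"
      unfolding mat_holomorphic_on_def forall_2 S'_def vector_2_nth using k S by simp
  next
    fix z :: complex assume z: "z \<in> ball 0 \<rho>"
    have "a * z \<noteq> 1"
    proof
      assume "a * z = 1"
      then have "norm a * norm z = 1" by (metis norm_mult norm_one)
      moreover from this have "0 < norm a" by auto
      then have "norm a * norm z < norm a * \<rho>" using z by simp
      ultimately show False using a by simp
    qed
    then have "det (M z) \<noteq> 0" unfolding det_2 M_def vector_2_nth by simp
    then show "invertible (Y z ** M z)"
      using fac z by (intro invertible_mult) (auto simp: factors_as_def invertible_det_nz)
  next
    fix z :: complex assume z: "1 < norm z" "norm z < \<rho>"
    then have [simp]: "z \<noteq> 0" by auto
    have w: "1 / z \<in> ball 0 1" using z by (simp add: norm_divide divide_less_eq_1)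
    have cz: "c * (z ^ nat (n - m) * z powi m) = c * z powi n"
    proof (cases "c = 0")
      case False
      then have "z ^ nat (n - m) = z powi (n - m)" using c by (simp add: power_int_def)
      then show ?thesis by (simp flip: power_int_add)
    qed simp
    have row2: "z powi n * S (1 / z) $ 2 $ j =
        - (c * z powi n) * S (1 / z) $ 1 $ j + (1 - a * z) * z powi (n - 1) * k j (1 / z)" for j
    proof -
      have "(1 - a * z) * z powi (n - 1) * k j (1 / z) = z powi n * ((1 / z - a) * k j (1 / z))"
        by (simp add: power_int_diff field_simps)
      also have "(1 / z - a) * k j (1 / z) = c * S (1 / z) $ 1 $ j + S (1 / z) $ 2 $ j"
        using k(2)[OF w] by simp
      finally show ?thesis by (simp add: algebra_simps)
    qed
    have "diag_powi m n z ** S (1 / z) = M z ** diag_powi m (n - 1) z ** S' (1 / z)"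
      unfolding vec_eq_iff forall_2 mat_mult_nth diag_powi_def M_def S'_def vector_2_nth
      by (simp add: row2 cz mult.assoc)
    then show "f z = Y z ** M z ** diag_powi m (n - 1) z ** S' (1 / z)"
      using fac z by (simp add: factors_as_def flip: matrix_mul_assoc)
  qed
  ultimately show ?thesis by (rule that[rotated])
qed

text \<open>
  A null row vector \<open>(v1, v2)\<close> of \<open>S a\<close> may be normalised at either entry. The operation is
  admissible if the changed row has the larger exponent or the other row does not take part; for at least one of
  the two rows this can be arranged, and the swap reduces the first row to the second.
\<close>
lemma remove_zero:
  assumes fac: "factors_as \<rho> f Y m n S" and a: "norm a < 1" "norm a * \<rho> \<le> 1" and "det (S a) = 0"
  obtains Y' m' n' S' where "factors_as \<rho> f Y' m' n' S'"
    "\<And>w. w \<in> ball 0 1 \<Longrightarrow> det (S w) = (w - a) * det (S' w)"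
proof -
  obtain v1 v2 where v: "v1 \<noteq> 0 \<or> v2 \<noteq> 0" "\<And>j. v1 * S a $ 1 $ j + v2 * S a $ 2 $ j = 0"
    using left_null_vector[OF \<open>det (S a) = 0\<close>] by blast
  \<comment> \<open>If both entries are nonzero, the row to be changed is the one with the larger exponent.\<close>
  show ?thesis
  proof (cases "v2 \<noteq> 0 \<and> (v1 = 0 \<or> m \<le> n)")
    case True
    then have "v1 / v2 * S a $ 1 $ j + S a $ 2 $ j = 0" for j
      using v(2)[of j] by (simp add: field_simps)
    then show ?thesis
      by (rule clear_row_zero[OF fac a]) (use True that in auto)
  next
    case False
    then have v1: "v1 \<noteq> 0" "v2 = 0 \<or> n \<le> m" using v(1) by auto
    define J :: cmat2 where "J = vector [vector [0, 1], vector [- 1, 0]]"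
    have fac': "factors_as \<rho> f (\<lambda>z. Y z ** inv2 J) n m (\<lambda>w. J ** S w)"
      unfolding J_def by (rule factors_as_swap[OF fac])
    have JS: "(J ** A) $ 1 $ j = A $ 2 $ j" "(J ** A) $ 2 $ j = - A $ 1 $ j" for A j
      unfolding mat_mult_nth J_def vector_2_nth by simp_all
    have "det (J ** A) = det A" for A unfolding det_2 JS by simp
    note detJ = this
    have "- v2 / v1 * (J ** S a) $ 1 $ j + (J ** S a) $ 2 $ j = 0" for j
    proof -
      have "S a $ 1 $ j = - (v2 * S a $ 2 $ j) / v1"
        using v(2)[of j] v1(1) nonzero_mult_div_cancel_left[of v1 "S a $ 1 $ j"]
        by (simp add: add_eq_0_iff2)
      then show ?thesis unfolding JS by simp
    qed
    then obtain Y' m' n' S' where "factors_as \<rho> f Y' m' n' S'"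
      "\<And>w. w \<in> ball 0 1 \<Longrightarrow> det (J ** S w) = (w - a) * det (S' w)"
      by (rule clear_row_zero[OF fac' a]) (use v1 in auto)
    then show ?thesis using that unfolding detJ by blast
  qed
qed

lemma mat_holomorphic_det: "S mat_holomorphic_on A \<Longrightarrow> (\<lambda>w. det (S w)) holomorphic_on A"
  unfolding mat_holomorphic_on_def det_2 by (auto intro!: holomorphic_intros)

lemma remove_all_zeros:
  assumes "factors_as \<rho> f Y m n S" "\<And>a. a \<in> set as \<Longrightarrow> norm a < 1 \<and> norm a * \<rho> \<le> 1"
    and u: "u holomorphic_on ball 0 1" "\<And>w. w \<in> ball 0 1 \<Longrightarrow> u w \<noteq> 0"
    and "\<And>w. w \<in> ball 0 1 \<Longrightarrow> det (S w) = (\<Prod>a\<leftarrow>as. w - a) * u w"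
  shows "\<exists>Y' m' n' S'. factors_as \<rho> f Y' m' n' S' \<and> (\<forall>w\<in>ball 0 1. invertible (S' w))"
  using assms(1,2,5)
proof (induction as arbitrary: Y m n S)
  case Nil
  then have "\<forall>w\<in>ball 0 1. invertible (S w)" using u(2) by (simp add: invertible_det_nz)
  with Nil(1) show ?case by blast
next
  case (Cons a as)
  have a: "norm a < 1" "norm a * \<rho> \<le> 1" using Cons.prems(2)[of a] by auto
  have "det (S a) = 0" using Cons.prems(3)[of a] a by simp
  then obtain Y' m' n' S' where fac: "factors_as \<rho> f Y' m' n' S'"
    and detS': "\<And>w. w \<in> ball 0 1 \<Longrightarrow> det (S w) = (w - a) * det (S' w)"
    using remove_zero[OF Cons.prems(1) a] by blast
  \<comment> \<open>Cancelling \<open>w - a\<close> is clear away from \<open>a\<close>, and continues to \<open>a\<close>.\<close>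
  have "det (S' w) = (\<Prod>a\<leftarrow>as. w - a) * u w" if "w \<in> ball 0 1" for w
  proof (rule analytic_continuation_open[of "ball 0 1 - {a}" "ball 0 1" "\<lambda>w. det (S' w)" "\<lambda>w. (\<Prod>a\<leftarrow>as. w - a) * u w"])
    show "ball 0 1 - {a} \<noteq> {}"
    proof -
      have "(if a = 0 then 1 / 2 else 0) \<in> ball 0 1 - {a}" by auto
      then show ?thesis by blast
    qed
    show "(\<lambda>w. det (S' w)) holomorphic_on ball 0 1"
      using fac by (intro mat_holomorphic_det) (simp add: factors_as_def)
    have "(\<lambda>w. \<Prod>a\<leftarrow>as. w - a) holomorphic_on ball 0 1"
      by (induction as) (auto intro!: holomorphic_intros)
    then show "(\<lambda>w. (\<Prod>a\<leftarrow>as. w - a) * u w) holomorphic_on ball 0 1"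
      by (intro holomorphic_intros u)
    fix w assume "w \<in> ball 0 1 - {a}"
    then show "det (S' w) = (\<Prod>a\<leftarrow>as. w - a) * u w"
      using detS'[of w] Cons.prems(3)[of w] by auto
  qed (use that in auto)
  then show ?case by (intro Cons.IH[OF fac]) (use Cons.prems(2) in auto)
qed

section \<open>The factorization\<close>

text \<open>
  Let \<open>p\<close> be a truncation of \<open>f\<close>, so close to \<open>f\<close> that \<open>p ** inv2 f\<close> is near the identity. From
  \<open>X ** p ** inv2 f = Y\<close> follows \<open>f = inv2 Y ** (X ** p)\<close>, where \<open>X ** p\<close> is \<open>z ^ N\<close> times a
  holomorphic function of \<open>1 / z\<close>. The determinant of the latter may still vanish at some points.
\<close>
lemma scalar_factorization:
  fixes f :: "complex \<Rightarrow> cmat2"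
  assumes f: "f mat_holomorphic_on ball 0 4 - {0}"
    and inv: "\<And>z. z \<in> ball 0 4 - {0} \<Longrightarrow> invertible (f z)"
  obtains Y N S where "factors_as (7/4) f Y N N S"
proof -
  have inv_f: "(\<lambda>z. inv2 (f z)) mat_holomorphic_on ball 0 4 - {0}"
    by (rule mat_holomorphic_inv2[OF f inv])
  let ?K = "cball 0 3 - ball 0 (1/3) :: complex set"
  have "continuous_on ?K (\<lambda>z. inv2 (f z))"
    by (rule mat_holomorphic_imp_continuous, rule mat_holomorphic_subset[OF inv_f]) auto
  then have "compact ((\<lambda>z. inv2 (f z)) ` ?K)"
    by (intro compact_continuous_image compact_diff) auto
  then obtain B where B: "0 < B" "\<And>z. z \<in> ?K \<Longrightarrow> norm (inv2 (f z)) \<le> B"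
    using bounded_pos compact_imp_bounded by (metis imageI)
  have \<eta>: "0 < 1 / (200 * B)" using \<open>0 < B\<close> by simp
  obtain N and P :: "complex \<Rightarrow> cmat2" where P: "P mat_holomorphic_on UNIV"
    and close: "\<And>z i j. \<lbrakk>1/3 < norm z; norm z < 3\<rbrakk> \<Longrightarrow>
      norm (z ^ N * P (1 / z) $ i $ j - f z $ i $ j) \<le> 1 / (200 * B)"
  proof (rule Laurent_truncation_mat[OF f \<eta>])
  qed (rule that)
  define p :: "complex \<Rightarrow> cmat2" where "p z = (\<chi> i j. z ^ N * P (1 / z) $ i $ j)" for z
  define F where "F z = p z ** inv2 (f z)" for z
  let ?A = "{z::complex. 1/3 < norm z \<and> norm z < 3}"
  have "p mat_holomorphic_on ?A"
  proof -
    have "(\<lambda>z. P (1 / z)) mat_holomorphic_on ?A"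
      by (rule mat_holomorphic_compose[OF P]) (auto intro!: holomorphic_intros)
    then show ?thesis
      unfolding mat_holomorphic_on_def p_def by (auto intro!: holomorphic_intros)
  qed
  then have F: "F mat_holomorphic_on ?A"
    unfolding F_def by (intro mat_holomorphic_mult mat_holomorphic_subset[OF inv_f]) auto
  have near: "norm (F z $ i $ j - (mat 1 :: cmat2) $ i $ j) \<le> 1 / 100"
    if z: "1/3 < norm z" "norm z < 3" for z i j
  proof -
    have "z \<in> ball 0 4 - {0}" "z \<in> ?K" using z by auto
    then have one: "f z ** inv2 (f z) = mat 1" and "norm (inv2 (f z)) \<le> B"
      using inv2_right[OF inv] B(2) by auto
    have e: "norm ((p z $ i $ k - f z $ i $ k) * inv2 (f z) $ k $ j) \<le> 1 / (200 * B) * B" for k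
      unfolding norm_mult p_def vec_lambda_beta
      by (intro mult_mono close[OF z] order_trans[OF _ \<open>norm (inv2 (f z)) \<le> B\<close>]
          order_trans[OF Finite_Cartesian_Product.norm_nth_le] Finite_Cartesian_Product.norm_nth_le)
        (use \<open>0 < B\<close> in auto)
    have "F z $ i $ j - (mat 1 :: cmat2) $ i $ j =
        (p z $ i $ 1 - f z $ i $ 1) * inv2 (f z) $ 1 $ j + (p z $ i $ 2 - f z $ i $ 2) * inv2 (f z) $ 2 $ j"
      unfolding one[symmetric] F_def mat_mult_nth by (simp add: algebra_simps)
    also have "norm \<dots> \<le> 1 / (200 * B) * B + 1 / (200 * B) * B"
      by (intro order_trans[OF norm_triangle_ineq] add_mono e)
    also have "\<dots> = 1 / 100" using \<open>0 < B\<close> by simp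
    finally show ?thesis .
  qed
  obtain X Y where X: "X mat_holomorphic_on ball 0 1" and Y: "Y mat_holomorphic_on ball 0 (7/4)"
    "\<And>z. z \<in> ball 0 (7/4) \<Longrightarrow> invertible (Y z)"
    "\<And>z. \<lbrakk>1 < norm z; norm z < 7/4\<rbrakk> \<Longrightarrow> X (1 / z) ** F z = Y z"
  proof (rule near_identity_factor[OF F near], assumption, assumption)
  qed (rule that)
  have "factors_as (7/4) f (\<lambda>z. inv2 (Y z)) (int N) (int N) (\<lambda>w. X w ** P w)"
    unfolding factors_as_def
  proof (intro conjI ballI allI impI)
    fix z :: complex assume z: "1 < norm z" "norm z < 7/4"
    then have "z \<in> ball 0 4 - {0}" by auto
    have "inv2 (Y z) ** diag_powi (int N) (int N) z ** (X (1 / z) ** P (1 / z)) = inv2 (Y z) ** (X (1 / z) ** p z)"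
    proof -
      have "diag_powi (int N) (int N) z ** (X (1 / z) ** P (1 / z)) = X (1 / z) ** p z"
        unfolding vec_eq_iff forall_2 mat_mult_nth diag_powi_def vector_2_nth p_def
        by (simp add: algebra_simps)
      then show ?thesis by (simp flip: matrix_mul_assoc)
    qed
    also have "X (1 / z) ** p z = X (1 / z) ** p z ** (inv2 (f z) ** f z)"
      using inv2_left[OF inv[OF \<open>z \<in> ball 0 4 - {0}\<close>]] by simp
    also have "\<dots> = Y z ** f z"
      unfolding Y(3)[OF z, symmetric] F_def by (simp add: matrix_mul_assoc)
    also have "inv2 (Y z) ** (Y z ** f z) = f z"
      using inv2_left[OF Y(2)[of z]] z by (simp add: matrix_mul_assoc)
    finally show "f z = inv2 (Y z) ** diag_powi (int N) (int N) z ** (X (1 / z) ** P (1 / z))" by simp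
  qed (use X Y P in \<open>auto intro!: mat_holomorphic_inv2 invertible_inv2 mat_holomorphic_mult
      intro: mat_holomorphic_subset\<close>)
  then show ?thesis by (rule that)
qed

lemma invertible_diag_powi: "z \<noteq> 0 \<Longrightarrow> invertible (diag_powi m n z)"
  by (simp add: invertible_det_nz det_2 diag_powi_def)

text \<open>
  On the annulus \<open>f\<close>, \<open>Y\<close> and the diagonal are invertible, hence so is \<open>S\<close>. The zeros of \<open>det S\<close>
  thus lie in the compact disc of radius \<open>4 / 7\<close>; there are finitely many of them, and they can be
  removed one by one.
\<close>
lemma Birkhoff_factorization_annulus:
  assumes f: "f mat_holomorphic_on ball 0 4 - {0}"
    and inv: "\<And>z. z \<in> ball 0 4 - {0} \<Longrightarrow> invertible (f z)"
  obtains Y m n S where "factors_as (7/4) f Y m n S" "\<And>w. w \<in> ball 0 1 \<Longrightarrow> invertible (S w)"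
proof -
  obtain Y N S where fac: "factors_as (7/4) f Y N N S" using scalar_factorization[OF f inv] by blast
  define Z where "Z = {w \<in> ball 0 1. det (S w) = 0}"
  have hol: "(\<lambda>w. det (S w)) holomorphic_on ball 0 1"
    using fac by (intro mat_holomorphic_det) (simp add: factors_as_def)
  have nz: "det (S w) \<noteq> 0" if w: "4/7 < norm w" "norm w < 1" for w
  proof -
    have "w \<noteq> 0" using w by auto
    have z: "1 < norm (1 / w)" "norm (1 / w) < 7/4" using w \<open>w \<noteq> 0\<close> by (simp_all add: norm_divide field_simps)
    have "f (1 / w) = Y (1 / w) ** diag_powi N N (1 / w) ** S w"
      using fac z by (simp add: factors_as_def)
    moreover have "det (f (1 / w)) \<noteq> 0"
      using inv[of "1 / w"] z \<open>w \<noteq> 0\<close> by (simp add: invertible_det_nz)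
    ultimately show ?thesis by (auto simp: det_mul)
  qed
  have Z_le: "norm a \<le> 4/7" if "a \<in> Z" for a using nz[of a] that unfolding Z_def by force
  have "(3/4 :: complex) \<in> ball 0 1" "det (S (3/4)) \<noteq> 0" using nz[of "3/4"] by auto
  then have "3/4 \<notin> Z" "Z \<subseteq> ball 0 1" by (auto simp: Z_def)
  then have "Z \<noteq> ball 0 1" using \<open>3/4 \<in> ball 0 1\<close> by blast
  have "finite Z"
  proof (cases "(\<lambda>w. det (S w)) constant_on ball 0 1")
    case True
    then obtain d where d: "\<And>w. w \<in> ball 0 1 \<Longrightarrow> det (S w) = d"
      unfolding constant_on_def by blast
    have "d \<noteq> 0" using d[OF \<open>3/4 \<in> ball 0 1\<close>] \<open>det (S (3/4)) \<noteq> 0\<close> by simp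
    then have "Z = {}" using d unfolding Z_def by blast
    then show ?thesis by simp
  next
    case False
    have "finite {w \<in> cball 0 (4/7). det (S w) = 0}"
      by (rule holomorphic_compact_finite_zeros[OF hol _ _ _ _ False]) auto
    then show ?thesis by (rule finite_subset[rotated]) (use Z_le in \<open>auto simp: Z_def\<close>)
  qed
  then obtain as u where as: "set as \<subseteq> Z" and u: "u holomorphic_on ball 0 1"
    "\<And>w. w \<in> ball 0 1 \<Longrightarrow> u w \<noteq> 0" "\<And>w. w \<in> ball 0 1 \<Longrightarrow> det (S w) = (\<Prod>a\<leftarrow>as. w - a) * u w"
    by (rule holomorphic_finite_zeros_factor[of Z "ball 0 1" "\<lambda>w. det (S w)"])
       (use hol \<open>Z \<noteq> ball 0 1\<close> in \<open>auto simp: Z_def\<close>)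
  have "\<exists>Y' m' n' S'. factors_as (7/4) f Y' m' n' S' \<and> (\<forall>w\<in>ball 0 1. invertible (S' w))"
    by (rule remove_all_zeros[OF fac _ u]) (use as Z_le in force)+
  then show ?thesis using that by blast
qed

text \<open>
  The third factor is given near infinity by \<open>S (1 / z)\<close> and on the punctured disc by solving the
  factorization for it; both expressions agree on the annulus, so they glue to a holomorphic map on
  the punctured plane.
\<close>
lemma Birkhoff_factorization_disc:
  assumes f: "f mat_holomorphic_on ball 0 4 - {0}"
    and inv: "\<And>z. z \<in> ball 0 4 - {0} \<Longrightarrow> invertible (f z)"
  obtains Y m n G L where
    "Y mat_holomorphic_on ball 0 (7/4)" "\<And>z. z \<in> ball 0 (7/4) \<Longrightarrow> invertible (Y z)"
    "G mat_holomorphic_on - {0}" "\<And>z. z \<noteq> 0 \<Longrightarrow> invertible (G z)" "invertible L"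
    "(\<lambda>w. if w = 0 then L else G (1 / w)) mat_holomorphic_on UNIV"
    "\<And>z. z \<in> cball 0 1 - {0} \<Longrightarrow> f z = Y z ** diag_powi m n z ** G z"
proof -
  obtain Y m n S where fac: "factors_as (7/4) f Y m n S" and S_inv: "\<And>w. w \<in> ball 0 1 \<Longrightarrow> invertible (S w)"
    using Birkhoff_factorization_annulus[OF f inv] by blast
  have Y: "Y mat_holomorphic_on ball 0 (7/4)" "\<And>z. z \<in> ball 0 (7/4) \<Longrightarrow> invertible (Y z)"
    and S: "S mat_holomorphic_on ball 0 1"
    and eq: "\<And>z. \<lbrakk>1 < norm z; norm z < 7/4\<rbrakk> \<Longrightarrow> f z = Y z ** diag_powi m n z ** S (1 / z)"
    using fac by (auto simp: factors_as_def)
  define H where "H z = inv2 (Y z ** diag_powi m n z) ** f z" for z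
  define G where "G z = (if 1 < norm z then S (1 / z) else H z)" for z
  have YD: "invertible (Y z ** diag_powi m n z)" if "z \<in> ball 0 (7/4) - {0}" for z
    using that by (intro invertible_mult Y invertible_diag_powi) auto
  have GH: "G z = H z" if "z \<in> ball 0 (7/4) - {0}" for z
  proof (cases "1 < norm z")
    case True
    then have "f z = Y z ** diag_powi m n z ** S (1 / z)" using that by (intro eq) auto
    then have "H z = inv2 (Y z ** diag_powi m n z) ** (Y z ** diag_powi m n z) ** S (1 / z)"
      unfolding H_def by (simp add: matrix_mul_assoc)
    then show ?thesis using True inv2_left[OF YD[OF that]] by (simp add: G_def)
  qed (simp add: G_def)
  have "H mat_holomorphic_on ball 0 (7/4) - {0}"
    unfolding H_def
  proof (intro mat_holomorphic_mult mat_holomorphic_inv2 YD)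
    show "diag_powi m n mat_holomorphic_on ball 0 (7/4) - {0}"
      unfolding mat_holomorphic_on_def forall_2 diag_powi_def vector_2_nth
      by (auto intro!: holomorphic_intros)
  qed (auto intro: mat_holomorphic_subset[OF Y(1)] mat_holomorphic_subset[OF f])
  then have "G mat_holomorphic_on ball 0 (7/4) - {0}"
    by (rule mat_holomorphic_transform) (simp add: GH)
  moreover have SG: "(\<lambda>z. S (1 / z)) mat_holomorphic_on - cball 0 1"
    by (rule mat_holomorphic_compose[OF S])
       (auto intro!: holomorphic_intros simp: norm_divide divide_less_eq_1)
  have "G mat_holomorphic_on - cball 0 1"
    by (rule mat_holomorphic_transform[OF SG]) (simp add: G_def)
  ultimately have "G mat_holomorphic_on (ball 0 (7/4) - {0}) \<union> - cball 0 1"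
    by (intro mat_holomorphic_Un) auto
  moreover have "(ball 0 (7/4) - {0}) \<union> - cball 0 1 = - {0::complex}" by auto
  ultimately have G: "G mat_holomorphic_on - {0}" by simp
  have G_inv: "invertible (G z)" if "z \<noteq> 0" for z
  proof (cases "1 < norm z")
    case True
    then show ?thesis
      using S_inv[of "1 / z"] that by (simp add: G_def norm_divide divide_less_eq_1)
  next
    case False
    then have "z \<in> ball 0 (7/4) - {0}" "z \<in> ball 0 4 - {0}" using that by auto
    then show ?thesis
      using False by (simp add: G_def H_def invertible_mult invertible_inv2 YD inv)
  qed
  let ?C = "\<lambda>w. if w = 0 then S 0 else G (1 / w)"
  have C_S: "?C mat_holomorphic_on ball 0 1"
  proof (rule mat_holomorphic_transform[OF S])
    show "S w = ?C w" if "w \<in> ball 0 1" for w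
      using that by (simp add: G_def norm_divide)
  qed
  have C_G: "(\<lambda>w. G (1 / w)) mat_holomorphic_on - {0}"
    by (rule mat_holomorphic_compose[OF G]) (auto intro!: holomorphic_intros)
  have "?C mat_holomorphic_on - {0}"
    by (rule mat_holomorphic_transform[OF C_G]) simp
  then have "?C mat_holomorphic_on ball 0 1 \<union> - {0}"
    by (intro mat_holomorphic_Un C_S) auto
  moreover have "ball 0 1 \<union> - {0::complex} = UNIV" by auto
  ultimately have C: "?C mat_holomorphic_on UNIV" by simp
  have fin: "f z = Y z ** diag_powi m n z ** G z" if "z \<in> cball 0 1 - {0}" for z
  proof -
    have z: "z \<in> ball 0 (7/4) - {0}" using that by auto
    then show ?thesis
      unfolding GH[OF z] H_def by (simp add: matrix_mul_assoc inv2_right[OF YD[OF z]])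
  qed
  show ?thesis
    by (rule that[OF Y G G_inv S_inv[of 0] C fin]) auto
qed

lemma diag_powi_scale: "diag_powi m n (c * z) = diag_powi m n c ** diag_powi m n z"
  unfolding vec_eq_iff forall_2 mat_mult_nth diag_powi_def vector_2_nth
  by (simp add: power_int_mult_distrib)

theorem theorem6p1:
  fixes f :: germ
  assumes "f \<in> carrier LGL2"
  shows "\<exists>f\<^sub>p\<in>LGL2_plus. \<exists>f\<^sub>m\<in>LGL2_minus. \<exists>n\<^sub>1 n\<^sub>2 :: int.
           f = f\<^sub>p \<otimes>\<^bsub>LGL2\<^esub> germ 1 (diag_powi n\<^sub>1 n\<^sub>2) \<otimes>\<^bsub>LGL2\<^esub> f\<^sub>m"
proof -
  obtain R g where g: "(R, g) \<in> punctured_maps" "f = germ R g"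
    using assms by (auto simp: carrier_LGL2_iff)
  \<comment> \<open>Rescale so that \<open>g\<close> is defined on the punctured disc of radius \<open>4\<close>.\<close>
  define c where "c = complex_of_real (R / 4)"
  have "0 < R" using g(1) by (simp add: punctured_maps_def)
  then have c: "c \<noteq> 0" "norm c = R / 4" by (simp_all add: c_def norm_divide)
  have cz: "c * z \<in> ball 0 R - {0}" if "z \<in> ball 0 4 - {0}" for z
    using that c \<open>0 < R\<close> mult_strict_right_mono[of "norm z" 4 "norm c"]
    by (simp add: norm_mult mult.commute)
  have hol: "(\<lambda>z. g (c * z)) mat_holomorphic_on ball 0 4 - {0}"
    by (rule mat_holomorphic_compose[where T = "ball 0 R - {0}"])
       (use g cz in \<open>auto simp: punctured_maps_def intro!: holomorphic_intros\<close>)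
  have inv: "invertible (g (c * z))" if "z \<in> ball 0 4 - {0}" for z
    using cz[OF that] g(1) by (simp add: punctured_maps_def)
  obtain Y m n G L where Y: "Y mat_holomorphic_on ball 0 (7/4)"
    "\<And>z. z \<in> ball 0 (7/4) \<Longrightarrow> invertible (Y z)"
    and G: "G mat_holomorphic_on - {0}" "\<And>z. z \<noteq> 0 \<Longrightarrow> invertible (G z)" "invertible L"
    "(\<lambda>w. if w = 0 then L else G (1 / w)) mat_holomorphic_on UNIV"
    and eq: "\<And>z. z \<in> cball 0 1 - {0} \<Longrightarrow> g (c * z) = Y z ** diag_powi m n z ** G z"
  proof (rule Birkhoff_factorization_disc[OF hol inv], assumption)
  qed (rule that)
  \<comment> \<open>In the diagonal factor, rescaling back produces a constant matrix, which is absorbed on the left.\<close>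
  define gp where "gp z = Y (z / c) ** diag_powi m n (1 / c)" for z
  define gm where "gm z = G (z / c)" for z
  let ?U = "ball 0 (7/4 * (R/4)) :: complex set"
  have zc: "z / c \<in> ball 0 (7/4)" if "z \<in> ?U" for z
    using that c \<open>0 < R\<close> by (simp add: norm_divide field_simps)
  have gp: "gp mat_holomorphic_on ?U" "\<And>z. z \<in> ?U \<Longrightarrow> invertible (gp z)" "cball 0 (R/4) \<subseteq> ?U"
  proof -
    show "gp mat_holomorphic_on ?U"
      unfolding gp_def
      by (intro mat_holomorphic_mult mat_holomorphic_const mat_holomorphic_compose[OF Y(1)])
         (use zc c in \<open>auto intro!: holomorphic_intros\<close>)
    show "invertible (gp z)" if "z \<in> ?U" for z
      unfolding gp_def using c zc[OF that] by (intro invertible_mult Y invertible_diag_powi) auto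
  qed (use \<open>0 < R\<close> in auto)
  have gm: "gm mat_holomorphic_on - {0}" "\<And>z. z \<in> - {0} \<Longrightarrow> invertible (gm z)"
    unfolding gm_def using c G(2)
    by (auto intro!: mat_holomorphic_compose[OF G(1)] holomorphic_intros)
  have "(\<lambda>w. if c * w = 0 then L else G (1 / (c * w))) mat_holomorphic_on UNIV"
    by (rule mat_holomorphic_compose[OF G(4)]) (auto intro!: holomorphic_intros)
  then have gm_inf: "(\<lambda>w. if w = 0 then L else gm (1 / w)) mat_holomorphic_on UNIV"
    using c by (simp add: gm_def mult.commute cong: if_cong)
  have pm: "(R/4, gp) \<in> punctured_maps" "(R/4, gm) \<in> punctured_maps"
    using gp gm \<open>0 < R\<close>
    by (auto intro!: punctured_maps_holomorphic[OF _ gp(1)] punctured_maps_holomorphic[OF _ gm(1)])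
  have "germ (R/4) gp \<in> LGL2_plus"
    unfolding LGL2_plus_def using gp \<open>0 < R\<close> open_ball by (auto intro!: exI[of _ "R/4"] exI[of _ gp] exI[of _ ?U])
  moreover have "germ (R/4) gm \<in> LGL2_minus"
    unfolding LGL2_minus_def using gm gm_inf G(3) \<open>0 < R\<close> by (auto intro!: exI[of _ "R/4"] exI[of _ gm] exI[of _ L])
  moreover have "f = germ (R/4) gp \<otimes>\<^bsub>LGL2\<^esub> germ 1 (diag_powi m n) \<otimes>\<^bsub>LGL2\<^esub> germ (R/4) gm"
  proof -
    note pm1 = punctured_maps_mult[OF pm(1) diag_powi_punctured_maps]
    have "germ R g = germ (min (min (R/4) 1) (R/4)) (\<lambda>z. gp z ** diag_powi m n z ** gm z)"
    proof (rule germ_eqI[OF g(1) punctured_maps_mult[OF pm1 pm(2)], where r = "R/4"])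
      fix z :: complex assume z: "z \<noteq> 0" "norm z \<le> R/4"
      then have "z / c \<in> cball 0 1 - {0}" using c \<open>0 < R\<close> by (simp add: norm_divide)
      from eq[OF this] show "g z = gp z ** diag_powi m n z ** gm z"
        using c diag_powi_scale[of m n "1 / c" z] by (simp add: gp_def gm_def matrix_mul_assoc)
    qed (use \<open>0 < R\<close> in simp)
    then show ?thesis
      by (simp add: g(2) germ_mult[OF pm(1) diag_powi_punctured_maps] germ_mult[OF pm1 pm(2)])
  qed
  ultimately show ?thesis by blast
qed

end
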